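(* Let $(\mathcal S,\mathcal A)$ be a quantum graph acting irreducibly on a finite-dimensional Hilbert space $H$, and let $(\mathcal R,\mathcal C)$ be its skeleton. Then $(\mathcal R,\mathcal C)$ is a quantum graph and $(\mathcal S,\mathcal A)$ is a full pullback of $(\mathcal R,\mathcal C)$.
   Context: An operator system in $\mathcal B(H)$ is a selfadjoint linear subspace containing $I_H$; $\mathcal A'$ is the commutant. A quantum graph $(\mathcal S,\mathcal A)$ acting on a finite-dimensional Hilbert space $H$ consists of a von Neumann algebra $\mathcal A=\mathcal A''\subseteq\mathcal B(H)$ (with $I_H\in\mathcal A$) and an operator system $\mathcal S\subseteq\mathcal B(H)$ with $\mathcal A'\mathcal S\mathcal A'\subseteq\mathcal S$. It acts irreducibly if there is no non-trivial closed subspace $L\subseteq H$ reducing $\mathcal S$ such that $s\mapsto s|_L$, $\mathcal S\to\mathcal B(L)$, is completely isometric. Multiplier algebra: for $\mathcal S$ acting irreducibly on $H$, the C*-envelope of $\mathcal S$ is $\mathrm C^*(\mathcal S)\subseteq\mathcal B(H)$ and $\mathcal A_{\mathcal S}=\{a\in\mathrm C^*(\mathcal S): a\mathcal S\subseteq\mathcal S,\ a^*\mathcal S\subseteq\mathcal S\}$, a unital C*-subalgebra of $\mathcal B(H)$. Skeleton: there are positive integers $\alpha_1,\dots,\alpha_k$ and $n_1,\dots,n_k$ such that, up to unitary equivalence (by which we identify), $H=\bigoplus_{i=1}^k(\mathbb C^{\alpha_i}\otimes\mathbb C^{n_i})$ and $\mathcal A_{\mathcal S}=\bigoplus_{i=1}^k(M_{\alpha_i}\otimes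 I_{n_i})$. Let $p_i$ be the projection onto $H_i=\mathbb C^{\alpha_i}\otimes\mathbb C^{n_i}$, and set $\mathcal S_{ij}=p_i\mathcal Sp_j\subseteq\mathcal B(H_j,H_i)\cong M_{\alpha_i,\alpha_j}\otimes M_{n_i,n_j}$. Let $L_{\varepsilon_{11}^{(j,i)}}\colon M_{\alpha_i,\alpha_j}\otimes M_{n_i,n_j}\to M_{n_i,n_j}$ be the slice map $a\otimes b\mapsto\operatorname{Tr}(\varepsilon_{11}^{(j,i)}a)\,b$, where $\varepsilon_{11}^{(j,i)}$ is the $(1,1)$ matrix unit of $M_{\alpha_j,\alpha_i}$, and put $\mathcal R_{ij}=L_{\varepsilon_{11}^{(j,i)}}(\mathcal S_{ij})\subseteq M_{n_i,n_j}$. With $L=\bigoplus_{i=1}^k\mathbb C^{n_i}$, the skeleton of $(\mathcal S,\mathcal A)$ is $(\mathcal R,\mathcal C)$, where $\mathcal C=\bigoplus_{i=1}^kM_{n_i}\subseteq\mathcal B(L)$ (block-diagonal) and $\mathcal R=\bigoplus_{i,j=1}^k\mathcal R_{ij}\subseteq\mathcal B(L)$ (block operator matrices with $(i,j)$ entry in $\mathcal R_{ij}$). Full pullback: $(\mathcal S,\mathcal A)$ is a full pullback of $(\mathcal R,\mathcal C)$ if there is a faithful unital $*$-homomorphism $\theta\colon\mathcal C\to\mathcal A$ with Kraus operators $v_1,\dots,v_r\in\mathcal B(H,L)$ (i.e. $\theta(x)=\sum_iv_i^*xv_i$ for all $x\in\mathcal C$) such that $v_i^*\mathcal Rv_j\subseteq\mathcal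 S$ and $v_i\mathcal Sv_j^*\subseteq\mathcal R$ for all $i,j$. *)

theory Defs
  imports "Jordan_Normal_Form.Schur_Decomposition" Complex_Main
begin

text \<open>The Hilbert space of dimension \<open>d\<close> is \<open>carrier_vec d\<close> over the complex numbers with the inner
  product \<open>v \<bullet>c w\<close>, so that \<open>B(H)\<close> is \<open>carrier_mat d d\<close> and the adjoint is
  \<open>mat_adjoint\<close>.\<close>

section \<open>Norms\<close>

definition vnorm :: "complex vec \<Rightarrow> real" where
  "vnorm v = sqrt (Re (v \<bullet>c v))"

definition op_norm_on :: "complex vec set \<Rightarrow> complex mat \<Rightarrow> real" where
  "op_norm_on V A = (SUP v\<in>{v \<in> V. vnorm v \<le> 1}. vnorm (A *\<^sub>v v))"

definition op_norm :: "complex mat \<Rightarrow> real" where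
  "op_norm A = op_norm_on (carrier_vec (dim_col A)) A"

definition vec_closed :: "nat \<Rightarrow> complex vec set \<Rightarrow> bool" where
  "vec_closed d V \<longleftrightarrow> (\<forall>X. \<forall>v\<in>carrier_vec d.
     (\<forall>t::nat. X t \<in> V) \<longrightarrow> (\<lambda>t. vnorm (X t - v)) \<longlonglongrightarrow> 0 \<longrightarrow> v \<in> V)"

definition op_closed :: "nat \<Rightarrow> complex mat set \<Rightarrow> bool" where
  "op_closed d B \<longleftrightarrow> (\<forall>X. \<forall>x\<in>carrier_mat d d.
     (\<forall>t::nat. X t \<in> B) \<longrightarrow> (\<lambda>t. op_norm (X t - x)) \<longlonglongrightarrow> 0 \<longrightarrow> x \<in> B)"

definition vec_subspace :: "nat \<Rightarrow> complex vec set \<Rightarrow> bool" where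
  "vec_subspace d V \<longleftrightarrow> VectorSpace.subspace class_ring V (module_vec TYPE(complex) d)"

definition op_subspace :: "nat \<Rightarrow> complex mat set \<Rightarrow> bool" where
  "op_subspace d B \<longleftrightarrow> VectorSpace.subspace class_ring B (module_mat TYPE(complex) d d)"

section \<open>Quantum graphs\<close>

definition star_subalgebra :: "nat \<Rightarrow> complex mat set \<Rightarrow> bool" where
  "star_subalgebra d B \<longleftrightarrow> op_subspace d B
     \<and> (\<forall>x\<in>B. \<forall>y\<in>B. x * y \<in> B) \<and> (\<forall>x\<in>B. mat_adjoint x \<in> B)"

definition commutant :: "nat \<Rightarrow> complex mat set \<Rightarrow> complex mat set" where
  "commutant d B = {x \<in> carrier_mat d d. \<forall>b\<in>B. x * b = b * x}"

definition von_neumann_algebra :: "nat \<Rightarrow> complex mat set \<Rightarrow> bool" where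
  "von_neumann_algebra d A \<longleftrightarrow> star_subalgebra d A \<and> 1\<^sub>m d \<in> A
     \<and> A = commutant d (commutant d A)"

definition operator_system :: "nat \<Rightarrow> complex mat set \<Rightarrow> bool" where
  "operator_system d S \<longleftrightarrow> op_subspace d S \<and> (\<forall>s\<in>S. mat_adjoint s \<in> S) \<and> 1\<^sub>m d \<in> S"

definition quantum_graph :: "nat \<Rightarrow> complex mat set \<Rightarrow> complex mat set \<Rightarrow> bool" where
  "quantum_graph d S A \<longleftrightarrow> von_neumann_algebra d A \<and> operator_system d S
     \<and> (\<forall>a\<in>commutant d A. \<forall>s\<in>S. \<forall>b\<in>commutant d A. a * s * b \<in> S)"

section \<open>Irreducible action\<close>

definition orth_compl :: "nat \<Rightarrow> complex vec set \<Rightarrow> complex vec set" where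
  "orth_compl d V = {w \<in> carrier_vec d. \<forall>v\<in>V. w \<bullet>c v = 0}"

definition reduces :: "nat \<Rightarrow> complex vec set \<Rightarrow> complex mat set \<Rightarrow> bool" where
  "reduces d V S \<longleftrightarrow> (\<forall>s\<in>S. (\<forall>v\<in>V. s *\<^sub>v v \<in> V)
     \<and> (\<forall>w\<in>orth_compl d V. s *\<^sub>v w \<in> orth_compl d V))"

text \<open>An element of \<open>M\<^sub>m(B(H)) = B(H\<^sup>m)\<close>, and the subspace \<open>V\<^sup>m\<close> of \<open>H\<^sup>m\<close>; the
  \<open>i\<close>-th summand of \<open>H\<^sup>m\<close> occupies the coordinates \<open>i * d, \<dots>, i * d + d - 1\<close>.\<close>

definition amp_op :: "nat \<Rightarrow> nat \<Rightarrow> (nat \<Rightarrow> nat \<Rightarrow> complex mat) \<Rightarrow> complex mat" where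
  "amp_op m d s = mat (m * d) (m * d) (\<lambda>(p, q). s (p div d) (q div d) $$ (p mod d, q mod d))"

definition amp_space :: "nat \<Rightarrow> nat \<Rightarrow> complex vec set \<Rightarrow> complex vec set" where
  "amp_space m d V = {v \<in> carrier_vec (m * d). \<forall>i<m. vec d (\<lambda>p. v $ (i * d + p)) \<in> V}"

text \<open>For \<open>V\<close> invariant under \<open>S\<close>, the norm of \<open>(s\<^sub>i\<^sub>j|\<^sub>V)\<close> in
  \<open>M\<^sub>m(B(V)) = B(V\<^sup>m)\<close> is the supremum over the unit ball of \<open>V\<^sup>m\<close>.\<close>

definition restriction_completely_isometric ::
    "nat \<Rightarrow> complex mat set \<Rightarrow> complex vec set \<Rightarrow> bool" where
  "restriction_completely_isometric d S V \<longleftrightarrow>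
     (\<forall>m\<ge>1. \<forall>s. (\<forall>i<m. \<forall>j<m. s i j \<in> S) \<longrightarrow>
        op_norm_on (amp_space m d V) (amp_op m d s) = op_norm (amp_op m d s))"

definition acts_irreducibly :: "nat \<Rightarrow> complex mat set \<Rightarrow> bool" where
  "acts_irreducibly d S \<longleftrightarrow>
     \<not> (\<exists>V. vec_subspace d V \<and> vec_closed d V \<and> V \<noteq> {0\<^sub>v d} \<and> V \<noteq> carrier_vec d
        \<and> reduces d V S \<and> restriction_completely_isometric d S V)"

section \<open>The multiplier algebra\<close>

definition cstar_generated :: "nat \<Rightarrow> complex mat set \<Rightarrow> complex mat set" where
  "cstar_generated d S = \<Inter> {B. star_subalgebra d B \<and> op_closed d B \<and> S \<subseteq> B}"

text \<open>The generated C*-algebra is the C*-envelope of \<open>S\<close> when \<open>S\<close> acts irreducibly; the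
  definition is used only in that case.\<close>

definition multiplier_algebra :: "nat \<Rightarrow> complex mat set \<Rightarrow> complex mat set" where
  "multiplier_algebra d S =
     {a \<in> cstar_generated d S. \<forall>s\<in>S. a * s \<in> S \<and> mat_adjoint a * s \<in> S}"

section \<open>The skeleton\<close>

text \<open>\<open>tensor a b\<close> is the Kronecker product: the basis vector \<open>e\<^sub>a \<otimes> e\<^sub>m\<close> of
  \<open>\<complex>\<^sup>\<alpha> \<otimes> \<complex>\<^sup>n\<close> has index \<open>a * n + m\<close>.\<close>

definition tensor :: "complex mat \<Rightarrow> complex mat \<Rightarrow> complex mat" where
  "tensor a b = mat (dim_row a * dim_row b) (dim_col a * dim_col b)
     (\<lambda>(p, q). a $$ (p div dim_row b, q div dim_col b) * b $$ (p mod dim_row b, q mod dim_col b))"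

text \<open>\<open>slice_map nr nc w\<close> is the slice map of \<open>w \<in> M\<^sub>\<beta>\<^sub>,\<^sub>\<alpha>\<close> from
  \<open>M\<^sub>\<alpha>\<^sub>,\<^sub>\<beta> \<otimes> M\<^sub>n\<^sub>r\<^sub>,\<^sub>n\<^sub>c\<close> to \<open>M\<^sub>n\<^sub>r\<^sub>,\<^sub>n\<^sub>c\<close>; it is determined by its values
  on elementary tensors, which are given by \<open>slice_map_tensor\<close> below.\<close>

definition slice_map :: "nat \<Rightarrow> nat \<Rightarrow> complex mat \<Rightarrow> complex mat \<Rightarrow> complex mat" where
  "slice_map nr nc w x = mat nr nc
     (\<lambda>(p, q). \<Sum>b<dim_row w. \<Sum>a<dim_col w. w $$ (b, a) * x $$ (a * nr + p, b * nc + q))"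

lemma slice_map_tensor:
  assumes a: "a \<in> carrier_mat r c" and w: "w \<in> carrier_mat c r"
    and b: "b \<in> carrier_mat nr nc"
  shows "slice_map nr nc w (tensor a b) = (\<Sum>i<c. (w * a) $$ (i, i)) \<cdot>\<^sub>m b"
proof (rule eq_matI)
  have lt: "x * k + p < y * k" if "x < y" "p < k" for x y p k :: nat
  proof -
    have "x * k + p < Suc x * k" using that by simp
    also have "\<dots> \<le> y * k" using that by (intro mult_le_mono1) simp
    finally show ?thesis .
  qed
  fix p q
  assume "p < dim_row ((\<Sum>i<c. (w * a) $$ (i, i)) \<cdot>\<^sub>m b)"
    and "q < dim_col ((\<Sum>i<c. (w * a) $$ (i, i)) \<cdot>\<^sub>m b)"
  then have p: "p < nr" and q: "q < nc" using b by auto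
  have "slice_map nr nc w (tensor a b) $$ (p, q)
      = (\<Sum>y<c. \<Sum>x<r. w $$ (y, x) * (a $$ (x, y) * b $$ (p, q)))"
    using a b w p q by (auto simp: slice_map_def tensor_def lt intro!: sum.cong)
  also have "\<dots> = (\<Sum>i<c. (w * a) $$ (i, i)) * b $$ (p, q)"
    using a w by (auto simp: scalar_prod_def sum_distrib_right mult.assoc
        atLeast0LessThan intro!: sum.cong)
  finally show "slice_map nr nc w (tensor a b) $$ (p, q)
      = ((\<Sum>i<c. (w * a) $$ (i, i)) \<cdot>\<^sub>m b) $$ (p, q)"
    using b p q by simp
qed (use b in \<open>auto simp: slice_map_def\<close>)

definition unit11 :: "nat \<Rightarrow> nat \<Rightarrow> complex mat" where
  "unit11 r c = mat r c (\<lambda>(p, q). if p = 0 \<and> q = 0 then 1 else 0)"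

text \<open>\<open>block ds x i j\<close> is the corner \<open>p\<^sub>i x p\<^sub>j\<close>, seen as an operator from the \<open>j\<close>-th to the
  \<open>i\<close>-th summand of the orthogonal direct sum of spaces of dimensions \<open>ds 0, ds 1, \<dots>\<close>
  (the convention of \<open>diag_block_mat\<close>). Summands are numbered from \<open>0\<close>.\<close>

definition block :: "(nat \<Rightarrow> nat) \<Rightarrow> complex mat \<Rightarrow> nat \<Rightarrow> nat \<Rightarrow> complex mat" where
  "block ds x i j = mat (ds i) (ds j) (\<lambda>(p, q). x $$ ((\<Sum>l<i. ds l) + p, (\<Sum>l<j. ds l) + q))"

definition unitary_op :: "nat \<Rightarrow> complex mat \<Rightarrow> bool" where
  "unitary_op d U \<longleftrightarrow> U \<in> carrier_mat d d
     \<and> mat_adjoint U * U = 1\<^sub>m d \<and> U * mat_adjoint U = 1\<^sub>m d"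

definition conj_by :: "complex mat \<Rightarrow> complex mat set \<Rightarrow> complex mat set" where
  "conj_by U S = (\<lambda>s. U * s * mat_adjoint U) ` S"

definition ampliated_algebra :: "nat \<Rightarrow> (nat \<Rightarrow> nat) \<Rightarrow> (nat \<Rightarrow> nat) \<Rightarrow> complex mat set" where
  "ampliated_algebra k \<alpha> n =
     {diag_block_mat (map (\<lambda>i. tensor (a i) (1\<^sub>m (n i))) [0..<k]) | a.
        \<forall>i<k. a i \<in> carrier_mat (\<alpha> i) (\<alpha> i)}"

definition block_diagonal_algebra :: "nat \<Rightarrow> (nat \<Rightarrow> nat) \<Rightarrow> complex mat set" where
  "block_diagonal_algebra k n =
     {diag_block_mat (map c [0..<k]) | c. \<forall>i<k. c i \<in> carrier_mat (n i) (n i)}"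

text \<open>A unitary identification of \<open>H\<close> with the direct sum of the \<open>\<complex>\<^bsup>\<alpha> i\<^esup> \<otimes> \<complex>\<^bsup>n i\<^esup>\<close>
  that carries the multiplier algebra onto the direct sum of the \<open>M\<^bsub>\<alpha> i\<^esub> \<otimes> I\<^bsub>n i\<^esub>\<close>.\<close>

definition multiplier_decomposition ::
    "nat \<Rightarrow> complex mat set \<Rightarrow> nat \<Rightarrow> (nat \<Rightarrow> nat) \<Rightarrow> (nat \<Rightarrow> nat) \<Rightarrow> complex mat \<Rightarrow> bool" where
  "multiplier_decomposition d S k \<alpha> n U \<longleftrightarrow>
     (\<forall>i<k. \<alpha> i > 0 \<and> n i > 0) \<and> d = (\<Sum>i<k. \<alpha> i * n i) \<and> unitary_op d U
     \<and> conj_by U (multiplier_algebra d S) = ampliated_algebra k \<alpha> n"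

definition skeleton_entry ::
    "(nat \<Rightarrow> nat) \<Rightarrow> (nat \<Rightarrow> nat) \<Rightarrow> complex mat set \<Rightarrow> nat \<Rightarrow> nat \<Rightarrow> complex mat set" where
  "skeleton_entry \<alpha> n S i j =
     (\<lambda>s. slice_map (n i) (n j) (unit11 (\<alpha> j) (\<alpha> i)) (block (\<lambda>l. \<alpha> l * n l) s i j)) ` S"

definition skeleton_system ::
    "nat \<Rightarrow> (nat \<Rightarrow> nat) \<Rightarrow> (nat \<Rightarrow> nat) \<Rightarrow> complex mat set \<Rightarrow> complex mat set" where
  "skeleton_system k \<alpha> n S =
     {x \<in> carrier_mat (\<Sum>i<k. n i) (\<Sum>i<k. n i).
        \<forall>i<k. \<forall>j<k. block n x i j \<in> skeleton_entry \<alpha> n S i j}"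

text \<open>The decomposition is unique only up to the choice of the unitary identification and the order
  of the summands, so being a skeleton (on \<open>L\<close> of dimension \<open>e\<close>) is a relation.\<close>

definition is_skeleton ::
    "nat \<Rightarrow> complex mat set \<Rightarrow> nat \<Rightarrow> complex mat set \<Rightarrow> complex mat set \<Rightarrow> bool" where
  "is_skeleton d S e R C \<longleftrightarrow>
     (\<exists>k \<alpha> n U. multiplier_decomposition d S k \<alpha> n U \<and> e = (\<Sum>i<k. n i)
        \<and> R = skeleton_system k \<alpha> n (conj_by U S) \<and> C = block_diagonal_algebra k n)"

section \<open>Full pullbacks\<close>

definition faithful_unital_star_hom ::
    "nat \<Rightarrow> complex mat set \<Rightarrow> nat \<Rightarrow> complex mat set \<Rightarrow> (complex mat \<Rightarrow> complex mat) \<Rightarrow> bool" where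
  "faithful_unital_star_hom e C d A \<theta> \<longleftrightarrow>
     (\<forall>x\<in>C. \<theta> x \<in> A) \<and> inj_on \<theta> C \<and> \<theta> (1\<^sub>m e) = 1\<^sub>m d
     \<and> (\<forall>x\<in>C. \<forall>y\<in>C. \<theta> (x + y) = \<theta> x + \<theta> y \<and> \<theta> (x * y) = \<theta> x * \<theta> y)
     \<and> (\<forall>z. \<forall>x\<in>C. \<theta> (z \<cdot>\<^sub>m x) = z \<cdot>\<^sub>m \<theta> x) \<and> (\<forall>x\<in>C. \<theta> (mat_adjoint x) = mat_adjoint (\<theta> x))"

definition kraus_family ::
    "nat \<Rightarrow> complex mat set \<Rightarrow> nat \<Rightarrow> (complex mat \<Rightarrow> complex mat) \<Rightarrow> nat \<Rightarrow> (nat \<Rightarrow> complex mat) \<Rightarrow> bool"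
  where
  "kraus_family e C d \<theta> r v \<longleftrightarrow> (\<forall>i<r. v i \<in> carrier_mat e d)
     \<and> (\<forall>x\<in>C. \<theta> x = finsum (module_mat TYPE(complex) d d) (\<lambda>i. mat_adjoint (v i) * x * v i) {..<r})"

definition full_pullback ::
    "nat \<Rightarrow> complex mat set \<Rightarrow> complex mat set \<Rightarrow> nat \<Rightarrow> complex mat set \<Rightarrow> complex mat set \<Rightarrow> bool"
  where
  "full_pullback d S A e R C \<longleftrightarrow>
     (\<exists>\<theta> r v. faithful_unital_star_hom e C d A \<theta> \<and> kraus_family e C d \<theta> r v
        \<and> (\<forall>i<r. \<forall>j<r. (\<forall>x\<in>R. mat_adjoint (v i) * x * v j \<in> S)
                      \<and> (\<forall>s\<in>S. v i * s * mat_adjoint (v j) \<in> R)))"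

end

theory Submission
  imports Defs
begin

text \<open>Since \<open>I \<in> S\<close>, the commutant of \<open>A\<close> lies in the multiplier algebra \<open>A\<^sub>S\<close>; hence
  \<open>A\<^sub>S' \<subseteq> A'' = A\<close>, and \<open>A\<^sub>S'\<close> is the direct sum of the \<open>I\<^bsub>\<alpha> i\<^esub> \<otimes> M\<^bsub>n i\<^esub>\<close>, a copy of \<open>C\<close>.
  Moreover \<open>S\<close> is an \<open>A\<^sub>S\<close>-bimodule, so multiplying by the matrix units of the \<open>M\<^bsub>\<alpha> i\<^esub>\<close> moves every
  \<open>n\<^sub>i \<times> n\<^sub>j\<close> subblock of an element of \<open>S\<close> to the \<open>(1,1)\<close> position and back: an operator lies in
  \<open>S\<close> iff all its subblocks lie in the \<open>R\<^sub>i\<^sub>j\<close>. The Kraus operators are the \<open>v\<^sub>a = \<Oplus>\<^sub>i (e\<^sub>a\<^sup>* \<otimes> I)\<close>,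
  the summand being zero where \<open>a\<close> exceeds \<open>\<alpha> i\<close>; compressing and expanding by them only
  extracts or inserts subblocks.\<close>

section \<open>Entrywise facts about matrices\<close>

lemma adjoint_carrier [simp, intro]: "X \<in> carrier_mat r c \<Longrightarrow> mat_adjoint X \<in> carrier_mat c r"
  for X :: "complex mat"
  by (auto simp: mat_adjoint_def mat_of_rows_def)

lemma adjoint_index:
  fixes X :: "complex mat"
  assumes "X \<in> carrier_mat r c" "i < c" "j < r"
  shows "mat_adjoint X $$ (i, j) = cnj (X $$ (j, i))"
  using assms by (auto simp: mat_adjoint_def mat_of_rows_def)

lemma mult_index:
  fixes X :: "complex mat"
  assumes "X \<in> carrier_mat r l" "Y \<in> carrier_mat l c" "i < r" "j < c"
  shows "(X * Y) $$ (i, j) = (\<Sum>t<l. X $$ (i, t) * Y $$ (t, j))"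
  using assms by (auto simp: scalar_prod_def atLeast0LessThan intro!: sum.cong)

lemma adjoint_mult:
  fixes X :: "complex mat"
  assumes X: "X \<in> carrier_mat r l" and Y: "Y \<in> carrier_mat l c"
  shows "mat_adjoint (X * Y) = mat_adjoint Y * mat_adjoint X"
proof (rule eq_matI)
  have XY: "X * Y \<in> carrier_mat r c" using X Y by simp
  have P: "mat_adjoint Y * mat_adjoint X \<in> carrier_mat c r" using mult_carrier_mat[OF adjoint_carrier[OF Y] adjoint_carrier[OF X]] .
  note Xa = adjoint_carrier[OF X] and Ya = adjoint_carrier[OF Y]
  show "dim_row (mat_adjoint (X * Y)) = dim_row (mat_adjoint Y * mat_adjoint X)"
    "dim_col (mat_adjoint (X * Y)) = dim_col (mat_adjoint Y * mat_adjoint X)"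
    using adjoint_carrier[OF XY] P by auto
  fix i j
  assume "i < dim_row (mat_adjoint Y * mat_adjoint X)" "j < dim_col (mat_adjoint Y * mat_adjoint X)"
  then have ij: "i < c" "j < r" using P by auto
  show "mat_adjoint (X * Y) $$ (i, j) = (mat_adjoint Y * mat_adjoint X) $$ (i, j)"
    unfolding adjoint_index[OF XY ij] mult_index[OF X Y ij(2,1)] mult_index[OF Ya Xa ij]
    using ij by (auto simp: adjoint_index[OF X] adjoint_index[OF Y] mult.commute intro!: sum.cong)
qed

lemma adjoint_adjoint:
  fixes X :: "complex mat"
  assumes X: "X \<in> carrier_mat r c"
  shows "mat_adjoint (mat_adjoint X) = X"
proof (rule eq_matI)
  note a = adjoint_carrier[OF X]
  show "dim_row (mat_adjoint (mat_adjoint X)) = dim_row X"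
    "dim_col (mat_adjoint (mat_adjoint X)) = dim_col X"
    using carrier_matD[OF adjoint_carrier[OF a]] carrier_matD[OF X] by auto
qed (use X in \<open>auto simp: adjoint_index[OF adjoint_carrier[OF X]] adjoint_index[OF X]\<close>)

section \<open>Linear subspaces and finite sums of matrices\<close>

lemma op_subspace_iff:
  "op_subspace d B \<longleftrightarrow> B \<subseteq> carrier_mat d d \<and> 0\<^sub>m d d \<in> B
     \<and> (\<forall>x\<in>B. \<forall>y\<in>B. x + y \<in> B) \<and> (\<forall>z. \<forall>x\<in>B. z \<cdot>\<^sub>m x \<in> B)"
proof -
  have vs: "vectorspace class_ring (module_mat TYPE(complex) d d)" by (rule matrix_vs)
  then have "Module.module class_ring (module_mat TYPE(complex) d d)" by (simp add: vectorspace_def)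
  with vs show ?thesis
    unfolding op_subspace_def VectorSpace.subspace_def LinearCombinations.submodule_def
    by (auto simp: module_mat_simps class_ring_simps)
qed

lemma finsum_mat_carrier:
  assumes "\<And>t. t \<in> I \<Longrightarrow> f t \<in> carrier_mat r c"
  shows "finsum (module_mat TYPE(complex) r c) f I \<in> carrier_mat r c"
proof -
  interpret V: vectorspace "class_ring :: complex ring" "module_mat TYPE(complex) r c"
    by (rule matrix_vs)
  show ?thesis using V.finsum_closed[of f I] assms by (auto simp: module_mat_simps)
qed

text \<open>Kraus families are summed with \<open>finsum\<close> in the module of matrices, whereas
  the computations below go entry by entry; this bridges the two.\<close>

lemma finsum_mat_index:
  assumes "finite I" "\<And>t. t \<in> I \<Longrightarrow> f t \<in> carrier_mat r c" "i < r" "j < c"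
  shows "finsum (module_mat TYPE(complex) r c) f I $$ (i, j) = (\<Sum>t\<in>I. f t $$ (i, j))"
proof -
  interpret V: vectorspace "class_ring :: complex ring" "module_mat TYPE(complex) r c"
    by (rule matrix_vs)
  have "J \<subseteq> I \<Longrightarrow> finsum (module_mat TYPE(complex) r c) f J $$ (i, j) = (\<Sum>t\<in>J. f t $$ (i, j))"
    if "finite J" for J
    using that
  proof induction
    case empty
    then show ?case using assms by (simp add: module_mat_simps)
  next
    case (insert t J)
    have "finsum (module_mat TYPE(complex) r c) f (insert t J)
        = f t + finsum (module_mat TYPE(complex) r c) f J"
      using V.finsum_insert[OF insert(1,2), of f] insert.prems assms(2)
      by (auto simp: module_mat_simps)
    moreover have "finsum (module_mat TYPE(complex) r c) f J \<in> carrier_mat r c"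
      using insert.prems assms(2) by (intro finsum_mat_carrier) auto
    ultimately show ?case using insert assms by (auto simp: index_add_mat)
  qed
  then show "finsum (module_mat TYPE(complex) r c) f I $$ (i, j) = (\<Sum>t\<in>I. f t $$ (i, j))"
    using assms by simp
qed

text \<open>Finite sums are written as one \<open>mat\<close> with summed entries, which keeps them
  readable at a given position. The induction only uses that the empty sum is the zero matrix and
  that adding an index adds one matrix.\<close>

lemma op_subspace_sum_closed:
  assumes B: "op_subspace d B" and "finite I" "\<And>t. t \<in> I \<Longrightarrow> y t \<in> B"
  shows "mat d d (\<lambda>PQ. \<Sum>t\<in>I. y t $$ PQ) \<in> B"
  using assms(2,3)
proof induction
  case empty
  have "mat d d (\<lambda>PQ. \<Sum>t\<in>{}. y t $$ PQ) = 0\<^sub>m d d" by (rule eq_matI) auto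
  then show ?case using B unfolding op_subspace_iff by metis
next
  case (insert t I)
  have "y t \<in> carrier_mat d d" using insert.prems B unfolding op_subspace_iff by blast
  then have "mat d d (\<lambda>PQ. \<Sum>t\<in>insert t I. y t $$ PQ) = y t + mat d d (\<lambda>PQ. \<Sum>t\<in>I. y t $$ PQ)"
    using insert by (auto intro!: eq_matI)
  then show ?case using B insert unfolding op_subspace_iff by auto
qed

text \<open>Moves a case distinction out of a product, so that sums against matrices that are
  diagonal in some index collapse to a single term.\<close>

lemma mult_if_zero:
  fixes x y :: complex
  shows "(if c then x else 0) * y = (if c then x * y else 0)"
    and "y * (if c then x else 0) = (if c then y * x else 0)"
  by simp_all

lemma sum_eq_reindexed:
  fixes f :: "'a \<Rightarrow> complex"
  assumes "finite A" "inj_on g S" "g ` S \<subseteq> A" "\<And>x. x \<in> A \<Longrightarrow> x \<notin> g ` S \<Longrightarrow> f x = 0"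
  shows "sum f A = (\<Sum>s\<in>S. f (g s))"
  using sum.mono_neutral_right[of A "g ` S" f] sum.reindex[of g S f] assms by auto

text \<open>Distributivity for sums in entrywise form, by exchanging the two summations. With its
  mirror image it carries the unitary conjugation inside the Kraus sum.\<close>

lemma mult_sum_left:
  fixes X :: "complex mat"
  assumes X: "X \<in> carrier_mat p d" and Y: "\<And>t. t \<in> I \<Longrightarrow> Y t \<in> carrier_mat d q"
  shows "X * mat d q (\<lambda>PQ. \<Sum>t\<in>I. Y t $$ PQ) = mat p q (\<lambda>PQ. \<Sum>t\<in>I. (X * Y t) $$ PQ)"
proof (rule eq_matI)
  let ?M = "mat d q (\<lambda>PQ. \<Sum>t\<in>I. Y t $$ PQ)"
  have M: "?M \<in> carrier_mat d q" by simp
  fix P Q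
  assume "P < dim_row (mat p q (\<lambda>PQ. \<Sum>t\<in>I. (X * Y t) $$ PQ))"
    "Q < dim_col (mat p q (\<lambda>PQ. \<Sum>t\<in>I. (X * Y t) $$ PQ))"
  then have PQ: "P < p" "Q < q" by auto
  have "(X * ?M) $$ (P, Q) = (\<Sum>K<d. \<Sum>t\<in>I. X $$ (P, K) * Y t $$ (K, Q))"
    unfolding mult_index[OF X M PQ] using PQ by (simp add: sum_distrib_left)
  also have "\<dots> = (\<Sum>t\<in>I. (X * Y t) $$ (P, Q))"
    unfolding sum.swap[of _ I] by (intro sum.cong) (simp_all add: mult_index[OF X Y PQ])
  finally show "(X * ?M) $$ (P, Q) = mat p q (\<lambda>PQ. \<Sum>t\<in>I. (X * Y t) $$ PQ) $$ (P, Q)"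
    using PQ by simp
qed (use X in auto)

lemma mult_sum_right:
  fixes X :: "complex mat"
  assumes X: "X \<in> carrier_mat d q" and Y: "\<And>t. t \<in> I \<Longrightarrow> Y t \<in> carrier_mat p d"
  shows "mat p d (\<lambda>PQ. \<Sum>t\<in>I. Y t $$ PQ) * X = mat p q (\<lambda>PQ. \<Sum>t\<in>I. (Y t * X) $$ PQ)"
proof (rule eq_matI)
  let ?M = "mat p d (\<lambda>PQ. \<Sum>t\<in>I. Y t $$ PQ)"
  have M: "?M \<in> carrier_mat p d" by simp
  fix P Q
  assume "P < dim_row (mat p q (\<lambda>PQ. \<Sum>t\<in>I. (Y t * X) $$ PQ))"
    "Q < dim_col (mat p q (\<lambda>PQ. \<Sum>t\<in>I. (Y t * X) $$ PQ))"
  then have PQ: "P < p" "Q < q" by auto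
  have "(?M * X) $$ (P, Q) = (\<Sum>K<d. \<Sum>t\<in>I. Y t $$ (P, K) * X $$ (K, Q))"
    unfolding mult_index[OF M X PQ] using PQ by (simp add: sum_distrib_right)
  also have "\<dots> = (\<Sum>t\<in>I. (Y t * X) $$ (P, Q))"
    unfolding sum.swap[of _ I] by (intro sum.cong) (simp_all add: mult_index[OF Y X PQ])
  finally show "(?M * X) $$ (P, Q) = mat p q (\<lambda>PQ. \<Sum>t\<in>I. (Y t * X) $$ PQ) $$ (P, Q)"
    using PQ by simp
qed (use X in auto)

section \<open>Unitary conjugation\<close>

lemma op_closed_carrier: "op_closed d (carrier_mat d d)"
  by (simp add: op_closed_def)

text \<open>The full matrix algebra is itself a closed star subalgebra containing \<open>S\<close>,
  hence one of the sets being intersected.\<close>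

lemma cstar_generated_carrier:
  assumes "S \<subseteq> carrier_mat d d"
  shows "cstar_generated d S \<subseteq> carrier_mat d d"
proof -
  have "star_subalgebra d (carrier_mat d d)"
    by (auto simp: star_subalgebra_def op_subspace_iff)
  then show ?thesis using assms op_closed_carrier unfolding cstar_generated_def by blast
qed

text \<open>The inverse is a separate matrix \<open>W\<close> rather than
  \<open>mat_adjoint U\<close>, so that the same law applies with \<open>U\<close> and
  \<open>W\<close> exchanged when returning to the original space.\<close>

lemma conj_mult:
  fixes U :: "complex mat"
  assumes "U \<in> carrier_mat d d" "W \<in> carrier_mat d d" "X \<in> carrier_mat d d" "Y \<in> carrier_mat d d"
    and WU: "W * U = 1\<^sub>m d"
  shows "(U * X * W) * (U * Y * W) = U * (X * Y) * W"
proof -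
  have "(U * X * W) * (U * Y * W) = U * X * (W * U) * (Y * W)"
    using assms(1-4) by (simp add: assoc_mult_mat[of _ d d _ d _ d])
  then show ?thesis
    using assms by (simp add: assoc_mult_mat[of _ d d _ d _ d])
qed

lemma conj_conj:
  fixes U :: "complex mat"
  assumes "U \<in> carrier_mat d d" "W \<in> carrier_mat d d" "X \<in> carrier_mat d d"
    and WU: "W * U = 1\<^sub>m d"
  shows "W * (U * X * W) * U = X"
proof -
  have "W * (U * X * W) * U = (W * U) * X * (W * U)"
    using assms(1-3) by (simp add: assoc_mult_mat[of _ d d _ d _ d])
  then show ?thesis using assms by simp
qed

lemma conj_adjoint:
  fixes U :: "complex mat"
  assumes "U \<in> carrier_mat d d" "X \<in> carrier_mat d d"
  shows "mat_adjoint (U * X * mat_adjoint U) = U * mat_adjoint X * mat_adjoint U"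
  using assms adjoint_carrier[of U d d] adjoint_carrier[of X d d]
  by (simp add: adjoint_mult[of _ d d _ d] adjoint_adjoint[of _ d d] assoc_mult_mat[of _ d d _ d _ d])

lemma operator_system_conj:
  assumes S: "operator_system d S" and U: "unitary_op d U"
  shows "operator_system d (conj_by U S)"
proof -
  have Uc: "U \<in> carrier_mat d d" and UU: "U * mat_adjoint U = 1\<^sub>m d"
    using U by (auto simp: unitary_op_def)
  note Wc = adjoint_carrier[OF Uc]
  have sc: "s \<in> carrier_mat d d" if "s \<in> S" for s
    using S that by (auto simp: operator_system_def op_subspace_iff)
  have "0\<^sub>m d d \<in> conj_by U S"
    using S Uc Wc unfolding conj_by_def operator_system_def op_subspace_iff
    by (intro image_eqI[of _ _ "0\<^sub>m d d"]) (auto simp: left_mult_zero_mat[OF Wc])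
  moreover have "1\<^sub>m d \<in> conj_by U S"
    using S Uc Wc UU unfolding conj_by_def operator_system_def
    by (intro image_eqI[of _ _ "1\<^sub>m d"]) auto
  moreover have "U * s * mat_adjoint U + U * t * mat_adjoint U \<in> conj_by U S" if st: "s \<in> S" "t \<in> S" for s t
    unfolding conj_by_def
  proof (rule image_eqI)
    show "s + t \<in> S" using S st by (auto simp: operator_system_def op_subspace_iff)
    show "U * s * mat_adjoint U + U * t * mat_adjoint U = U * (s + t) * mat_adjoint U"
      using add_mult_distrib_mat[OF mult_carrier_mat[OF Uc sc[OF st(1)]] mult_carrier_mat[OF Uc sc[OF st(2)]] Wc]
      by (simp add: mult_add_distrib_mat[OF Uc sc[OF st(1)] sc[OF st(2)]])
  qed
  moreover have "z \<cdot>\<^sub>m (U * s * mat_adjoint U) \<in> conj_by U S" if s: "s \<in> S" for s z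
    unfolding conj_by_def
  proof (rule image_eqI)
    show "z \<cdot>\<^sub>m s \<in> S" using S s by (auto simp: operator_system_def op_subspace_iff)
    show "z \<cdot>\<^sub>m (U * s * mat_adjoint U) = U * (z \<cdot>\<^sub>m s) * mat_adjoint U"
      using Uc Wc sc[OF s]
      by (simp add: mult_smult_distrib[of _ d d _ d] mult_smult_assoc_mat[of _ d d _ d])
  qed
  moreover have "mat_adjoint (U * s * mat_adjoint U) \<in> conj_by U S" if s: "s \<in> S" for s
    unfolding conj_adjoint[OF Uc sc[OF s]] conj_by_def
    using S s by (auto simp: operator_system_def)
  moreover have "conj_by U S \<subseteq> carrier_mat d d"
    using mult_carrier_mat[OF mult_carrier_mat[OF Uc sc] Wc] by (auto simp: conj_by_def)
  ultimately show ?thesis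
    unfolding operator_system_def op_subspace_iff by (auto simp: conj_by_def)
qed

section \<open>The multiplier algebra and the commutant of \<open>A\<close>\<close>

lemma multiplier_carrier:
  assumes "operator_system d S"
  shows "multiplier_algebra d S \<subseteq> carrier_mat d d"
  using assms cstar_generated_carrier[of S d]
  by (auto simp: multiplier_algebra_def operator_system_def op_subspace_iff)

text \<open>Multipliers are defined by left multiplication only. Since \<open>S\<close> is
  selfadjoint, \<open>s * a\<close> is the adjoint of \<open>mat_adjoint a * mat_adjoint s\<close>,
  which lies in \<open>S\<close>.\<close>

lemma multiplier_right:
  assumes S: "operator_system d S" and a: "a \<in> multiplier_algebra d S" and s: "s \<in> S"
  shows "s * a \<in> S"
proof -
  have ac: "a \<in> carrier_mat d d" using multiplier_carrier[OF S] a by blast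
  have sc: "s \<in> carrier_mat d d" using S s by (auto simp: operator_system_def op_subspace_iff)
  have "mat_adjoint (mat_adjoint a * mat_adjoint s) \<in> S"
    using S a s by (auto simp: operator_system_def multiplier_algebra_def)
  then show ?thesis
    using ac sc by (simp add: adjoint_mult[of _ d d _ d] adjoint_adjoint[of _ d d])
qed

text \<open>An element \<open>b\<close> of the commutant equals \<open>b * 1\<close>, so it lies in
  \<open>S\<close> and therefore in the generated C*-algebra. The commutant is closed under adjoints
  because \<open>A\<close> is, so \<open>b\<close> and its adjoint both multiply \<open>S\<close>
  into itself.\<close>

lemma commutant_subset_multiplier:
  assumes qg: "quantum_graph d S A"
  shows "commutant d A \<subseteq> multiplier_algebra d S"
proof
  fix b assume b: "b \<in> commutant d A"
  have S: "operator_system d S" and A: "von_neumann_algebra d A"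
    and bimod: "\<And>a s b. a \<in> commutant d A \<Longrightarrow> s \<in> S \<Longrightarrow> b \<in> commutant d A \<Longrightarrow> a * s * b \<in> S"
    using qg by (auto simp: quantum_graph_def)
  have Ac: "A \<subseteq> carrier_mat d d" and Aa: "\<And>x. x \<in> A \<Longrightarrow> mat_adjoint x \<in> A"
    using A by (auto simp: von_neumann_algebra_def star_subalgebra_def op_subspace_iff)
  have bc: "b \<in> carrier_mat d d" using b by (simp add: commutant_def)
  \<comment> \<open>Taking the identity as the right factor turns the two-sided bimodule condition
    into left multiplication.\<close>
  have one: "1\<^sub>m d \<in> commutant d A" using Ac by (auto simp: commutant_def)
  have mem: "a * s \<in> S" if "a \<in> commutant d A" "s \<in> S" for a s
  proof -
    have "s \<in> carrier_mat d d" "a \<in> carrier_mat d d"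
      using S that by (auto simp: operator_system_def op_subspace_iff commutant_def)
    then show ?thesis using bimod[OF that one] by simp
  qed
  have "b * 1\<^sub>m d \<in> S" using mem[OF b] S by (simp add: operator_system_def)
  then have "b \<in> cstar_generated d S" using bc by (auto simp: cstar_generated_def)
  moreover have "mat_adjoint b \<in> commutant d A"
    unfolding commutant_def
  proof (intro CollectI conjI ballI)
    show "mat_adjoint b \<in> carrier_mat d d" using bc by simp
    fix x assume x: "x \<in> A"
    then have xc: "x \<in> carrier_mat d d" using Ac by blast
    \<comment> \<open>\<open>b\<close> commutes with the adjoint of \<open>x\<close>, which is again
      in \<open>A\<close>; taking adjoints of that equation gives the claim.\<close>
    have "mat_adjoint (b * mat_adjoint x) = mat_adjoint (mat_adjoint x * b)"
      using b Aa[OF x] by (simp add: commutant_def)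
    then show "mat_adjoint b * x = x * mat_adjoint b"
      using bc xc by (simp add: adjoint_mult[of _ d d _ d] adjoint_adjoint[of _ d d])
  qed
  ultimately show "b \<in> multiplier_algebra d S"
    using mem b by (simp add: multiplier_algebra_def)
qed

section \<open>Indexing of orthogonal direct sums\<close>

text \<open>The offset is the one used in \<open>block\<close>, and it matches the layout of
  \<open>diag_block_mat\<close>.\<close>

definition dpos :: "(nat \<Rightarrow> nat) \<Rightarrow> nat \<Rightarrow> nat \<Rightarrow> nat" where
  "dpos ds i p = (\<Sum>l<i. ds l) + p"

lemma dpos_less:
  assumes "i < k" "p < ds i"
  shows "dpos ds i p < (\<Sum>l<k. ds l)"
proof -
  have "dpos ds i p < (\<Sum>l<Suc i. ds l)" using assms by (simp add: dpos_def)
  also have "\<dots> \<le> (\<Sum>l<k. ds l)" using assms by (intro sum_mono2) auto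
  finally show ?thesis .
qed

text \<open>The blocks are consecutive intervals: positions in different blocks are strictly ordered
  by block number, and inside one block the offset cancels.\<close>

lemma dpos_eq_iff:
  assumes "p < ds i" "q < ds j"
  shows "dpos ds i p = dpos ds j q \<longleftrightarrow> i = j \<and> p = q"
proof -
  have "dpos ds i p < dpos ds j q" if "i < j" "p < ds i" for i j p q
    using dpos_less[of i j p ds] that by (simp add: dpos_def)
  from this[of i j p q] this[of j i q p] show ?thesis using assms
    by (cases i j rule: linorder_cases) (auto simp: dpos_def)
qed

lemma dpos_cases:
  assumes "P < (\<Sum>l<k. ds l)"
  obtains i p where "i < k" "p < ds i" "P = dpos ds i p"
proof -
  have "\<exists>i<k. \<exists>p<ds i. P = dpos ds i p" using assms
  proof (induction k)
    case (Suc k)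
    show ?case
    proof (cases "P < (\<Sum>l<k. ds l)")
      case True
      then show ?thesis using Suc.IH less_SucI by blast
    next
      case False
      then have "P - (\<Sum>l<k. ds l) < ds k" "P = dpos ds k (P - (\<Sum>l<k. ds l))"
        using Suc.prems by (auto simp: dpos_def)
      then show ?thesis by blast
    qed
  qed simp
  then show ?thesis using that by blast
qed

lemma diag_block_carrier:
  assumes "\<And>i. i < k \<Longrightarrow> B i \<in> carrier_mat (ds i) (ds i)"
  shows "diag_block_mat (map B [0..<k]) \<in> carrier_mat (\<Sum>i<k. ds i) (\<Sum>i<k. ds i)"
proof -
  have "map dim_row (map B [0..<k]) = map ds [0..<k]" "map dim_col (map B [0..<k]) = map ds [0..<k]"
    using carrier_matD[OF assms] by auto
  moreover have "sum_list (map ds [0..<k]) = (\<Sum>i<k. ds i)"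
    by (simp add: sum_list_distinct_conv_sum_set atLeast0LessThan)
  ultimately show ?thesis by (intro carrier_matI) (simp_all only: dim_diag_block_mat)
qed

text \<open>Induction on the number of blocks: the last one is split off by
  \<open>four_block_mat\<close>, and the bounds from \<open>dpos_less\<close> decide which of the
  four quadrants contains the position.\<close>

lemma diag_block_index:
  assumes "\<And>i. i < k \<Longrightarrow> B i \<in> carrier_mat (ds i) (ds i)" "i < k" "j < k" "p < ds i" "q < ds j"
  shows "diag_block_mat (map B [0..<k]) $$ (dpos ds i p, dpos ds j q) = (if i = j then B i $$ (p, q) else 0)"
  using assms
proof (induction k)
  case (Suc k)
  let ?D = "diag_block_mat (map B [0..<k])"
  have D: "?D \<in> carrier_mat (\<Sum>i<k. ds i) (\<Sum>i<k. ds i)" using Suc.prems by (intro diag_block_carrier) auto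
  have Bk: "B k \<in> carrier_mat (ds k) (ds k)" using Suc.prems by auto
  have e: "diag_block_mat (map B [0..<Suc k])
      = four_block_mat ?D (0\<^sub>m (\<Sum>i<k. ds i) (ds k)) (0\<^sub>m (ds k) (\<Sum>i<k. ds i)) (B k)"
    using D Bk by (simp add: diag_block_mat_last Let_def)
  have less: "dpos ds i p < (\<Sum>l<k. ds l)" if "i < k" "p < ds i" for i p using that by (rule dpos_less)
  have lt: "dpos ds i p < (\<Sum>l<k. ds l) + ds k" "dpos ds j q < (\<Sum>l<k. ds l) + ds k"
    using dpos_less[of i "Suc k" p ds] dpos_less[of j "Suc k" q ds] Suc.prems by auto
  have ge: "dpos ds k p = (\<Sum>l<k. ds l) + p" for p by (simp add: dpos_def)
  consider "i < k" "j < k" | "i < k" "j = k" | "i = k" "j < k" | "i = k" "j = k"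
    using Suc.prems by linarith
  then show ?case
    unfolding e using lt carrier_matD[OF D] carrier_matD[OF Bk] Suc.prems Suc.IH less[of i p] less[of j q]
    by cases (simp_all add: ge)
qed simp

locale multiplicity_spaces =
  fixes k :: nat and \<alpha> n :: "nat \<Rightarrow> nat"
begin

abbreviation dim_H :: nat where "dim_H \<equiv> \<Sum>i<k. \<alpha> i * n i"
abbreviation dim_L :: nat where "dim_L \<equiv> \<Sum>i<k. n i"

text \<open>\<open>hpos i a m\<close> is the index of the basis vector \<open>e\<^sub>a \<otimes> e\<^sub>m\<close> of the \<open>i\<close>-th summand of \<open>H\<close>, and
  \<open>lpos i m\<close> that of the basis vector \<open>e\<^sub>m\<close> of the \<open>i\<close>-th summand of \<open>L\<close>.\<close>

definition hpos :: "nat \<Rightarrow> nat \<Rightarrow> nat \<Rightarrow> nat" where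
  "hpos i a m = dpos (\<lambda>l. \<alpha> l * n l) i (a * n i + m)"

abbreviation lpos :: "nat \<Rightarrow> nat \<Rightarrow> nat" where "lpos \<equiv> dpos n"

text \<open>A Kronecker index is a direct sum index for \<open>r\<close> blocks of the same size
  \<open>c\<close>, so the facts about \<open>dpos\<close> apply to it.\<close>

lemma pair_index_less: "a < r \<Longrightarrow> m < c \<Longrightarrow> a * c + m < r * c" for a m c r :: nat
  using dpos_less[of a r m "\<lambda>_. c"] by (simp add: dpos_def)

lemma hpos_less: "i < k \<Longrightarrow> a < \<alpha> i \<Longrightarrow> m < n i \<Longrightarrow> hpos i a m < dim_H"
  unfolding hpos_def by (rule dpos_less) (auto simp: pair_index_less)

lemma lpos_less: "i < k \<Longrightarrow> m < n i \<Longrightarrow> lpos i m < dim_L"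
  by (rule dpos_less)

text \<open>Two layers of \<open>dpos_eq_iff\<close>: one separates the summands of H, the other,
  with constant block size \<open>n i\<close>, separates the two tensor factors.\<close>

lemma hpos_eq_iff:
  assumes "a < \<alpha> i" "m < n i" "b < \<alpha> j" "m' < n j"
  shows "hpos i a m = hpos j b m' \<longleftrightarrow> i = j \<and> a = b \<and> m = m'"
  using dpos_eq_iff[of "a * n i + m" "\<lambda>l. \<alpha> l * n l" i "b * n j + m'" j]
    dpos_eq_iff[of m "\<lambda>_. n i" a m' b] assms
  by (auto simp: hpos_def pair_index_less dpos_def)

lemma lpos_eq_iff: "m < n i \<Longrightarrow> m' < n j \<Longrightarrow> lpos i m = lpos j m' \<longleftrightarrow> i = j \<and> m = m'"
  by (rule dpos_eq_iff)

lemma hpos_cases: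
  assumes "P < dim_H"
  obtains i a m where "i < k" "a < \<alpha> i" "m < n i" "P = hpos i a m"
proof -
  obtain i p where ip: "i < k" "p < \<alpha> i * n i" "P = dpos (\<lambda>l. \<alpha> l * n l) i p"
    using dpos_cases[OF assms] by blast
  obtain a m where "a < \<alpha> i" "m < n i" "p = dpos (\<lambda>_. n i) a m"
    using dpos_cases[of p "\<lambda>_. n i" "\<alpha> i"] ip(2) by auto
  with ip show ?thesis using that[of i a m] by (simp add: hpos_def dpos_def)
qed

lemma lpos_cases:
  assumes "P < dim_L"
  obtains i m where "i < k" "m < n i" "P = lpos i m"
  using dpos_cases[OF assms] by blast

lemma mat_eq_hposI:
  assumes "X \<in> carrier_mat dim_H dim_H" "Y \<in> carrier_mat dim_H dim_H"
    and "\<And>i a m j b m'. i < k \<Longrightarrow> a < \<alpha> i \<Longrightarrow> m < n i \<Longrightarrow> j < k \<Longrightarrow> b < \<alpha> j \<Longrightarrow> m' < n j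
      \<Longrightarrow> X $$ (hpos i a m, hpos j b m') = Y $$ (hpos i a m, hpos j b m')"
  shows "X = Y"
proof (rule eq_matI)
  fix P Q
  assume "P < dim_row Y" "Q < dim_col Y"
  then have "P < dim_H" "Q < dim_H" using assms by auto
  then show "X $$ (P, Q) = Y $$ (P, Q)"
    using assms(3) by (elim hpos_cases) simp
qed (use assms in auto)

lemma mat_eq_lposI:
  assumes "X \<in> carrier_mat dim_L dim_L" "Y \<in> carrier_mat dim_L dim_L"
    and "\<And>i m j m'. i < k \<Longrightarrow> m < n i \<Longrightarrow> j < k \<Longrightarrow> m' < n j
      \<Longrightarrow> X $$ (lpos i m, lpos j m') = Y $$ (lpos i m, lpos j m')"
  shows "X = Y"
proof (rule eq_matI)
  fix P Q
  assume "P < dim_row Y" "Q < dim_col Y"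
  then have "P < dim_L" "Q < dim_L" using assms by auto
  then show "X $$ (P, Q) = Y $$ (P, Q)"
    using assms(3) by (elim lpos_cases) simp
qed (use assms in auto)

text \<open>For products with elements of M_\<alpha> tensor I: the summand and the index in the
  second factor are fixed, and only the multiplicity index runs.\<close>

lemma sum_hpos_multiplicity:
  fixes f :: "nat \<Rightarrow> complex"
  assumes "i < k" "m < n i"
    and "\<And>j b m'. j < k \<Longrightarrow> b < \<alpha> j \<Longrightarrow> m' < n j \<Longrightarrow> \<not> (j = i \<and> m' = m) \<Longrightarrow> f (hpos j b m') = 0"
  shows "(\<Sum>P<dim_H. f P) = (\<Sum>a<\<alpha> i. f (hpos i a m))"
proof (rule sum_eq_reindexed)
  show "inj_on (\<lambda>a. hpos i a m) {..<\<alpha> i}"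
    using assms by (auto simp: inj_on_def hpos_eq_iff)
  fix P
  assume P: "P \<in> {..<dim_H}" "P \<notin> (\<lambda>a. hpos i a m) ` {..<\<alpha> i}"
  obtain j b m' where jb: "j < k" "b < \<alpha> j" "m' < n j" "P = hpos j b m'"
    using P(1) by (auto elim: hpos_cases)
  with P(2) have "\<not> (j = i \<and> m' = m)" by blast
  then show "f P = 0" using assms(3)[OF jb(1-3)] jb(4) by simp
qed (use assms in \<open>auto simp: hpos_less\<close>)

text \<open>The counterpart for products with I tensor M_n: here the multiplicity index is fixed and
  the index in the second factor runs.\<close>

lemma sum_hpos_space:
  fixes f :: "nat \<Rightarrow> complex"
  assumes "i < k" "a < \<alpha> i"
    and "\<And>j b m'. j < k \<Longrightarrow> b < \<alpha> j \<Longrightarrow> m' < n j \<Longrightarrow> \<not> (j = i \<and> b = a) \<Longrightarrow> f (hpos j b m') = 0"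
  shows "(\<Sum>P<dim_H. f P) = (\<Sum>m<n i. f (hpos i a m))"
proof (rule sum_eq_reindexed)
  show "inj_on (hpos i a) {..<n i}"
    using assms by (auto simp: inj_on_def hpos_eq_iff)
  fix P
  assume P: "P \<in> {..<dim_H}" "P \<notin> hpos i a ` {..<n i}"
  obtain j b m' where jb: "j < k" "b < \<alpha> j" "m' < n j" "P = hpos j b m'"
    using P(1) by (auto elim: hpos_cases)
  with P(2) have "\<not> (j = i \<and> b = a)" by blast
  then show "f P = 0" using assms(3)[OF jb(1-3)] jb(4) by simp
qed (use assms in \<open>auto simp: hpos_less\<close>)

lemma sum_lpos:
  fixes f :: "nat \<Rightarrow> complex"
  assumes "i < k"
    and "\<And>j m'. j < k \<Longrightarrow> m' < n j \<Longrightarrow> j \<noteq> i \<Longrightarrow> f (lpos j m') = 0"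
  shows "(\<Sum>P<dim_L. f P) = (\<Sum>m<n i. f (lpos i m))"
proof (rule sum_eq_reindexed)
  show "inj_on (lpos i) {..<n i}"
    using assms by (auto simp: inj_on_def lpos_eq_iff)
  fix P
  assume P: "P \<in> {..<dim_L}" "P \<notin> lpos i ` {..<n i}"
  obtain j m' where jb: "j < k" "m' < n j" "P = lpos j m'"
    using P(1) by (auto elim: lpos_cases)
  with P(2) have "j \<noteq> i" by blast
  then show "f P = 0" using assms(2)[OF jb(1-2)] jb(3) by simp
qed (use assms in \<open>auto simp: lpos_less\<close>)

section \<open>The two block algebras\<close>

text \<open>Trades \<open>diag_block_mat\<close> and \<open>tensor\<close> for a pattern of entries;
  \<open>A i\<close> holds the coefficients of the i-th matrix in the first tensor factor.\<close>

lemma ampliated_algebra_iff: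
  "X \<in> ampliated_algebra k \<alpha> n \<longleftrightarrow> X \<in> carrier_mat dim_H dim_H \<and>
     (\<exists>A. \<forall>i<k. \<forall>a<\<alpha> i. \<forall>m<n i. \<forall>j<k. \<forall>b<\<alpha> j. \<forall>m'<n j.
        X $$ (hpos i a m, hpos j b m') = (if i = j \<and> m = m' then A i a b else 0))"
    (is "_ \<longleftrightarrow> _ \<and> (\<exists>A. ?ent X A)")
proof -
  let ?D = "\<lambda>a. diag_block_mat (map (\<lambda>i. tensor (a i) (1\<^sub>m (n i))) [0..<k])"
  have tc: "tensor (a i) (1\<^sub>m (n i)) \<in> carrier_mat (\<alpha> i * n i) (\<alpha> i * n i)"
    if "\<forall>i<k. a i \<in> carrier_mat (\<alpha> i) (\<alpha> i)" "i < k" for a i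
    using that by (auto simp: tensor_def)
  have D: "?D a \<in> carrier_mat dim_H dim_H \<and> ?ent (?D a) (\<lambda>i p q. a i $$ (p, q))"
    if a: "\<forall>i<k. a i \<in> carrier_mat (\<alpha> i) (\<alpha> i)" for a
  proof (intro conjI allI impI)
    show "?D a \<in> carrier_mat dim_H dim_H" using tc[OF a] by (intro diag_block_carrier)
    fix i p m j q m'
    assume ij: "i < k" "p < \<alpha> i" "m < n i" "j < k" "q < \<alpha> j" "m' < n j"
    have ai: "a i \<in> carrier_mat (\<alpha> i) (\<alpha> i)" using a ij by simp
    have "?D a $$ (hpos i p m, hpos j q m')
        = (if i = j then tensor (a i) (1\<^sub>m (n i)) $$ (p * n i + m, q * n j + m') else 0)"
      unfolding hpos_def by (rule diag_block_index) (use ij tc[OF a] pair_index_less in simp_all)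
    \<comment> \<open>The tensor entry is evaluated only for \<open>i = j\<close>, where both
      indices are in range.\<close>
    moreover have "tensor (a i) (1\<^sub>m (n i)) $$ (p * n i + m, q * n i + m')
        = (if m = m' then a i $$ (p, q) else 0)" if "i = j"
      using that ij ai by (simp add: tensor_def pair_index_less)
    ultimately show "?D a $$ (hpos i p m, hpos j q m') = (if i = j \<and> m = m' then a i $$ (p, q) else 0)"
      by (cases "i = j"; cases "m = m'") auto
  qed
  show ?thesis
  proof (intro iffI; (elim conjE exE)?)
    assume "X \<in> ampliated_algebra k \<alpha> n"
    then obtain a where "X = ?D a" "\<forall>i<k. a i \<in> carrier_mat (\<alpha> i) (\<alpha> i)"
      unfolding ampliated_algebra_def by blast
    with D[of a] show "X \<in> carrier_mat dim_H dim_H \<and> (\<exists>A. ?ent X A)"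
      by (intro conjI exI[of _ "\<lambda>i p q. a i $$ (p, q)"]) simp_all
  next
    fix A
    assume X: "X \<in> carrier_mat dim_H dim_H" and ent: "?ent X A"
    let ?a = "\<lambda>i. mat (\<alpha> i) (\<alpha> i) (\<lambda>(p, q). A i p q)"
    have a: "\<forall>i<k. ?a i \<in> carrier_mat (\<alpha> i) (\<alpha> i)" by simp
    have "X = ?D ?a"
    proof (rule mat_eq_hposI)
      show "X \<in> carrier_mat dim_H dim_H" "?D ?a \<in> carrier_mat dim_H dim_H"
        using X D[OF a] by blast+
      fix i p m j q m'
      assume ij: "i < k" "p < \<alpha> i" "m < n i" "j < k" "q < \<alpha> j" "m' < n j"
      have "?D ?a $$ (hpos i p m, hpos j q m') = (if i = j \<and> m = m' then ?a i $$ (p, q) else 0)"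
        by (rule conjunct2[OF D[OF a], rule_format, OF ij])
      also have "\<dots> = (if i = j \<and> m = m' then A i p q else 0)"
        using ij by (cases "i = j") auto
      also have "\<dots> = X $$ (hpos i p m, hpos j q m')" by (rule ent[rule_format, OF ij, symmetric])
      finally show "X $$ (hpos i p m, hpos j q m') = ?D ?a $$ (hpos i p m, hpos j q m')" ..
    qed
    with a show "X \<in> ampliated_algebra k \<alpha> n"
      unfolding ampliated_algebra_def mem_Collect_eq by (intro exI[of _ ?a] conjI)
  qed
qed

lemma block_diagonal_algebra_iff:
  "X \<in> block_diagonal_algebra k n \<longleftrightarrow> X \<in> carrier_mat dim_L dim_L \<and>
     (\<forall>i<k. \<forall>m<n i. \<forall>j<k. \<forall>m'<n j. i \<noteq> j \<longrightarrow> X $$ (lpos i m, lpos j m') = 0)"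
    (is "_ \<longleftrightarrow> _ \<and> ?ent X")
proof (intro iffI; (elim conjE)?)
  assume "X \<in> block_diagonal_algebra k n"
  then obtain c where c: "X = diag_block_mat (map c [0..<k])" "\<forall>i<k. c i \<in> carrier_mat (n i) (n i)"
    unfolding block_diagonal_algebra_def by blast
  have "X \<in> carrier_mat dim_L dim_L" using diag_block_carrier[of k c n] c by simp
  moreover have "?ent X"
  proof (intro allI impI)
    fix i m j m' assume "i < k" "m < n i" "j < k" "m' < n j" "i \<noteq> j"
    then show "X $$ (lpos i m, lpos j m') = 0"
      using diag_block_index[of k c n i j m m'] c by simp
  qed
  ultimately show "X \<in> carrier_mat dim_L dim_L \<and> ?ent X" ..
next
  assume X: "X \<in> carrier_mat dim_L dim_L" and ent: "?ent X"
  let ?c = "\<lambda>i. mat (n i) (n i) (\<lambda>(p, q). X $$ (lpos i p, lpos i q))"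
  have "X = diag_block_mat (map ?c [0..<k])"
  proof (rule mat_eq_lposI[OF X])
    show "diag_block_mat (map ?c [0..<k]) \<in> carrier_mat dim_L dim_L"
      by (rule diag_block_carrier) simp
    fix i m j m' assume i: "i < k" "m < n i" "j < k" "m' < n j"
    have "X $$ (lpos i m, lpos j m') = (if i = j then ?c i $$ (m, m') else 0)"
    proof (cases "i = j")
      case True
      then show ?thesis using i by simp
    next
      case False
      then show ?thesis using ent[rule_format, OF i] by simp
    qed
    also have "\<dots> = diag_block_mat (map ?c [0..<k]) $$ (lpos i m, lpos j m')"
      by (rule diag_block_index[of k ?c n i j m m', symmetric]) (use i in simp_all)
    finally show "X $$ (lpos i m, lpos j m') = diag_block_mat (map ?c [0..<k]) $$ (lpos i m, lpos j m')" .
  qed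
  moreover have "\<forall>i<k. ?c i \<in> carrier_mat (n i) (n i)" by simp
  ultimately show "X \<in> block_diagonal_algebra k n"
    unfolding block_diagonal_algebra_def mem_Collect_eq by (intro exI[of _ ?c] conjI)
qed

lemma star_subalgebra_block_diagonal: "star_subalgebra dim_L (block_diagonal_algebra k n)"
proof -
  have "x * y \<in> block_diagonal_algebra k n"
    if x: "x \<in> block_diagonal_algebra k n" and y: "y \<in> block_diagonal_algebra k n" for x y
  proof -
    have xc: "x \<in> carrier_mat dim_L dim_L" and yc: "y \<in> carrier_mat dim_L dim_L"
      using x y block_diagonal_algebra_iff by auto
    have "(x * y) $$ (lpos i m, lpos j m') = 0"
      if "i < k" "m < n i" "j < k" "m' < n j" "i \<noteq> j" for i m j m'
    proof -
      \<comment> \<open>The middle index lies in some block \<open>l\<close>. If \<open>l\<close>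
        differs from \<open>i\<close> the first factor vanishes; otherwise \<open>l = i\<close>
        differs from \<open>j\<close> and the second one does.\<close>
      have "x $$ (lpos i m, t) * y $$ (t, lpos j m') = 0" if "t < dim_L" for t
        using that
      proof (rule lpos_cases)
        fix l p assume "l < k" "p < n l" "t = lpos l p"
        then show ?thesis using x y \<open>i < k\<close> \<open>m < n i\<close> \<open>j < k\<close> \<open>m' < n j\<close> \<open>i \<noteq> j\<close>
          unfolding block_diagonal_algebra_iff by (cases "l = i") auto
      qed
      then show ?thesis using that
        by (auto simp: mult_index[OF xc yc] lpos_less intro!: sum.neutral)
    qed
    then show ?thesis using xc yc unfolding block_diagonal_algebra_iff by auto
  qed
  then show ?thesis
    unfolding star_subalgebra_def op_subspace_iff
    by (auto simp: block_diagonal_algebra_iff lpos_less adjoint_index[of _ dim_L dim_L])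
qed

section \<open>The commutant and bicommutant of the block-diagonal algebra\<close>

lemma commutant_block_diagonal_iff:
  "c \<in> commutant dim_L (block_diagonal_algebra k n) \<longleftrightarrow> c \<in> carrier_mat dim_L dim_L \<and>
     (\<exists>z. \<forall>i<k. \<forall>m<n i. \<forall>j<k. \<forall>m'<n j.
        c $$ (lpos i m, lpos j m') = (if i = j \<and> m = m' then z i else 0))"
    (is "_ \<longleftrightarrow> _ \<and> (\<exists>z. ?ent z)")
proof (intro iffI; (elim conjE exE)?)
  assume comm: "c \<in> commutant dim_L (block_diagonal_algebra k n)"
  then have c: "c \<in> carrier_mat dim_L dim_L" by (simp add: commutant_def)
  \<comment> \<open>These are the matrix units of the i-th block. In \<open>key\<close>, right
    multiplication by one leaves a single column of \<open>c\<close> and left multiplication a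
    single row, so commutation compares individual entries.\<close>
  let ?F = "\<lambda>i p q. mat dim_L dim_L (\<lambda>(P, Q). if P = lpos i p \<and> Q = lpos i q then 1 else 0 :: complex)"
  have key: "(if Q = lpos i q then c $$ (P, lpos i p) else 0)
      = (if P = lpos i p then c $$ (lpos i q, Q) else 0)"
    if i: "i < k" "p < n i" "q < n i" and PQ: "P < dim_L" "Q < dim_L" for i p q P Q
  proof -
    have F: "?F i p q \<in> carrier_mat dim_L dim_L" by simp
    have "?F i p q \<in> block_diagonal_algebra k n"
      using i by (auto simp: block_diagonal_algebra_iff lpos_less lpos_eq_iff)
    then have "(c * ?F i p q) $$ (P, Q) = (?F i p q * c) $$ (P, Q)"
      using comm by (simp add: commutant_def)
    moreover have "(c * ?F i p q) $$ (P, Q)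
        = (\<Sum>t<dim_L. if t = lpos i p then if Q = lpos i q then c $$ (P, lpos i p) else 0 else 0)"
      unfolding mult_index[OF c F PQ] using PQ by (intro sum.cong) auto
    moreover have "(?F i p q * c) $$ (P, Q)
        = (\<Sum>t<dim_L. if t = lpos i q then if P = lpos i p then c $$ (lpos i q, Q) else 0 else 0)"
      unfolding mult_index[OF F c PQ] using PQ by (intro sum.cong) auto
    ultimately show ?thesis using i by (simp add: lpos_less)
  qed
  \<comment> \<open>The scalar is read off at the first position of each block. The first instance
    of \<open>key\<close> below kills the off-diagonal entries; the second moves each diagonal entry
    to position 0, which exists because \<open>m < n i\<close>.\<close>
  have ent: "?ent (\<lambda>i. c $$ (lpos i 0, lpos i 0))"
  proof (intro allI impI)
    fix i m j m' assume i: "i < k" "m < n i" "j < k" "m' < n j"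
    show "c $$ (lpos i m, lpos j m') = (if i = j \<and> m = m' then c $$ (lpos i 0, lpos i 0) else 0)"
      using i key[of j m' m' "lpos i m" "lpos j m'"] key[of i m 0 "lpos i m" "lpos i 0"]
      by (auto simp: lpos_less lpos_eq_iff)
  qed
  show "c \<in> carrier_mat dim_L dim_L \<and> (\<exists>z. ?ent z)" by (rule conjI[OF c], rule exI, rule ent)
next
  fix z assume c: "c \<in> carrier_mat dim_L dim_L" and ent: "?ent z"
  have "c * x = x * c" if x: "x \<in> block_diagonal_algebra k n" for x
  proof (rule mat_eq_lposI)
    have xc: "x \<in> carrier_mat dim_L dim_L" using x by (simp add: block_diagonal_algebra_iff)
    show "c * x \<in> carrier_mat dim_L dim_L" "x * c \<in> carrier_mat dim_L dim_L" using c xc by auto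
    fix i m j m' assume i: "i < k" "m < n i" "j < k" "m' < n j"
    \<comment> \<open>Multiplying by \<open>c\<close> scales rows on the left and columns on the
      right. The factors agree on diagonal blocks, and the other blocks of \<open>x\<close> are
      zero.\<close>
    have "(c * x) $$ (lpos i m, lpos j m') = z i * x $$ (lpos i m, lpos j m')"
      using i ent unfolding mult_index[OF c xc lpos_less[OF i(1,2)] lpos_less[OF i(3,4)]]
      by (subst sum_lpos[of i]) (auto simp: mult_if_zero)
    moreover have "(x * c) $$ (lpos i m, lpos j m') = z j * x $$ (lpos i m, lpos j m')"
      using i ent unfolding mult_index[OF xc c lpos_less[OF i(1,2)] lpos_less[OF i(3,4)]]
      by (subst sum_lpos[of j]) (auto simp: mult_if_zero)
    ultimately show "(c * x) $$ (lpos i m, lpos j m') = (x * c) $$ (lpos i m, lpos j m')"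
      using i x by (cases "i = j") (auto simp: block_diagonal_algebra_iff)
  qed
  with c show "c \<in> commutant dim_L (block_diagonal_algebra k n)" by (simp add: commutant_def)
qed

lemma von_neumann_block_diagonal: "von_neumann_algebra dim_L (block_diagonal_algebra k n)"
proof -
  let ?C = "block_diagonal_algebra k n"
  have "x \<in> ?C" if x: "x \<in> commutant dim_L (commutant dim_L ?C)" for x
    unfolding block_diagonal_algebra_iff
  proof (intro conjI allI impI)
    show xc: "x \<in> carrier_mat dim_L dim_L" using x by (simp add: commutant_def)
    fix i m j m' assume i: "i < k" "m < n i" "j < k" "m' < n j" and ne: "i \<noteq> j"
    \<comment> \<open>\<open>p\<close> is the projection onto the i-th summand of L. It lies in the
      commutant, so \<open>x\<close> commutes with it; in block \<open>(i, j)\<close> the product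
      \<open>x * p\<close> is zero while \<open>p * x\<close> returns the entry of
      \<open>x\<close>.\<close>
    define p :: "complex mat" where
      "p = mat dim_L dim_L (\<lambda>(P, Q). if P = Q \<and> (\<exists>t<n i. P = lpos i t) then 1 else 0)"
    have p: "p \<in> carrier_mat dim_L dim_L" by (simp add: p_def)
    have "p \<in> commutant dim_L ?C"
      unfolding commutant_block_diagonal_iff using p
      by (intro conjI exI[of _ "\<lambda>l. if l = i then 1 else 0"])
        (auto simp: p_def lpos_less lpos_eq_iff)
    then have "(x * p) $$ (lpos i m, lpos j m') = (p * x) $$ (lpos i m, lpos j m')"
      using x by (simp add: commutant_def)
    moreover have "(x * p) $$ (lpos i m, lpos j m') = 0"
      unfolding mult_index[OF xc p lpos_less[OF i(1,2)] lpos_less[OF i(3,4)]]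
      using i ne by (intro sum.neutral) (auto simp: p_def lpos_less lpos_eq_iff)
    moreover have "(p * x) $$ (lpos i m, lpos j m') = x $$ (lpos i m, lpos j m')"
    proof -
      have "(p * x) $$ (lpos i m, lpos j m')
          = (\<Sum>t<dim_L. if t = lpos i m then x $$ (lpos i m, lpos j m') else 0)"
        unfolding mult_index[OF p xc lpos_less[OF i(1,2)] lpos_less[OF i(3,4)]]
        using i by (intro sum.cong) (auto simp: p_def lpos_less)
      then show ?thesis using i by (simp add: lpos_less)
    qed
    ultimately show "x $$ (lpos i m, lpos j m') = 0" by simp
  qed
  moreover have "?C \<subseteq> commutant dim_L (commutant dim_L ?C)"
    by (auto simp: commutant_def block_diagonal_algebra_iff)
  moreover have "1\<^sub>m dim_L \<in> ?C" by (auto simp: block_diagonal_algebra_iff lpos_less lpos_eq_iff)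
  ultimately show ?thesis
    using star_subalgebra_block_diagonal by (auto simp: von_neumann_algebra_def)
qed

end

section \<open>Systems that are bimodules over the ampliated algebra\<close>

locale bimodule_system = multiplicity_spaces +
  fixes T :: "complex mat set"
  assumes multiplicity_pos: "i < k \<Longrightarrow> 0 < \<alpha> i"
    and system: "operator_system dim_H T"
    and left: "a \<in> ampliated_algebra k \<alpha> n \<Longrightarrow> s \<in> T \<Longrightarrow> a * s \<in> T"
    and right: "a \<in> ampliated_algebra k \<alpha> n \<Longrightarrow> s \<in> T \<Longrightarrow> s * a \<in> T"
begin

lemma subspace: "op_subspace dim_H T"
  and adjoint_closed: "s \<in> T \<Longrightarrow> mat_adjoint s \<in> T"
  and one_mem: "1\<^sub>m dim_H \<in> T"
  using system by (auto simp: operator_system_def)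

lemma carrier: "s \<in> T \<Longrightarrow> s \<in> carrier_mat dim_H dim_H"
  using subspace unfolding op_subspace_iff by blast

text \<open>\<open>corner i j f\<close> says that the matrix with entries \<open>f p q\<close> lies in the skeleton entry
  \<open>R\<^sub>i\<^sub>j\<close>.\<close>

definition corner :: "nat \<Rightarrow> nat \<Rightarrow> (nat \<Rightarrow> nat \<Rightarrow> complex) \<Rightarrow> bool" where
  "corner i j f \<longleftrightarrow> (\<exists>s\<in>T. \<forall>p<n i. \<forall>q<n j. f p q = s $$ (hpos i 0 p, hpos j 0 q))"

lemma corner_cong:
  assumes "corner i j f" "\<And>p q. p < n i \<Longrightarrow> q < n j \<Longrightarrow> f p q = g p q"
  shows "corner i j g"
  using assms unfolding corner_def by metis

lemma zero_less: "i < k \<Longrightarrow> p < n i \<Longrightarrow> hpos i 0 p < dim_H"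
  using hpos_less multiplicity_pos by blast

text \<open>This and the next four facts pass the operator system structure of \<open>T\<close> to
  the skeleton entries: each witness is obtained by doing the same operation inside
  \<open>T\<close>, with the adjoint exchanging the two summands.\<close>

lemma corner_zero:
  assumes "i < k" "j < k"
  shows "corner i j (\<lambda>p q. 0)"
proof -
  have "0\<^sub>m dim_H dim_H \<in> T" using subspace unfolding op_subspace_iff by blast
  then show ?thesis using assms unfolding corner_def by (intro bexI) (auto simp: zero_less)
qed

lemma corner_add:
  assumes "i < k" "j < k" "corner i j f" "corner i j g"
  shows "corner i j (\<lambda>p q. f p q + g p q)"
proof -
  obtain s t where s: "s \<in> T" "\<forall>p<n i. \<forall>q<n j. f p q = s $$ (hpos i 0 p, hpos j 0 q)"
    and t: "t \<in> T" "\<forall>p<n i. \<forall>q<n j. g p q = t $$ (hpos i 0 p, hpos j 0 q)"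
    using assms unfolding corner_def by blast
  have "s + t \<in> T" using s t subspace unfolding op_subspace_iff by blast
  then show ?thesis unfolding corner_def
    by (rule bexI[rotated]) (use assms(1,2) s t carrier[OF s(1)] carrier[OF t(1)] in \<open>auto simp: zero_less\<close>)
qed

lemma corner_smult:
  assumes "i < k" "j < k" "corner i j f"
  shows "corner i j (\<lambda>p q. z * f p q)"
proof -
  obtain s where s: "s \<in> T" "\<forall>p<n i. \<forall>q<n j. f p q = s $$ (hpos i 0 p, hpos j 0 q)"
    using assms unfolding corner_def by blast
  have "z \<cdot>\<^sub>m s \<in> T" using s subspace unfolding op_subspace_iff by blast
  then show ?thesis unfolding corner_def
    by (rule bexI[rotated]) (use assms(1,2) s carrier[OF s(1)] in \<open>auto simp: zero_less\<close>)
qed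

lemma corner_adjoint:
  assumes "i < k" "j < k" "corner i j f"
  shows "corner j i (\<lambda>p q. cnj (f q p))"
proof -
  obtain s where s: "s \<in> T" "\<forall>p<n i. \<forall>q<n j. f p q = s $$ (hpos i 0 p, hpos j 0 q)"
    using assms unfolding corner_def by blast
  show ?thesis unfolding corner_def
    by (rule bexI[OF _ adjoint_closed[OF s(1)]])
      (use assms(1,2) s in \<open>auto simp: zero_less adjoint_index[OF carrier[OF s(1)]]\<close>)
qed

lemma corner_one:
  assumes "i < k" "j < k"
  shows "corner i j (\<lambda>p q. if i = j \<and> p = q then 1 else 0)"
  unfolding corner_def
  by (rule bexI[OF _ one_mem]) (use assms multiplicity_pos in \<open>auto simp: zero_less hpos_eq_iff\<close>)

text \<open>This is the matrix unit \<open>(a, b)\<close> of M_\<alpha> tensored with the identity,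
  acting on the i-th summand of H.\<close>

definition unit_op :: "nat \<Rightarrow> nat \<Rightarrow> nat \<Rightarrow> complex mat" where
  "unit_op i a b = mat dim_H dim_H
     (\<lambda>(P, Q). if \<exists>m<n i. P = hpos i a m \<and> Q = hpos i b m then 1 else 0)"

lemma unit_op_carrier: "unit_op i a b \<in> carrier_mat dim_H dim_H"
  by (simp add: unit_op_def)

lemma unit_op_mem:
  assumes "i < k" "a < \<alpha> i" "b < \<alpha> i"
  shows "unit_op i a b \<in> ampliated_algebra k \<alpha> n"
  unfolding ampliated_algebra_iff
  by (intro conjI unit_op_carrier exI[of _ "\<lambda>l c c'. if l = i \<and> c = a \<and> c' = b then 1 else 0"])
    (use assms in \<open>auto simp: unit_op_def hpos_less hpos_eq_iff\<close>)

lemma unit_op_mult_left: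
  assumes X: "X \<in> carrier_mat dim_H dim_H" and i: "i < k" "a < \<alpha> i" "b < \<alpha> i"
    and l: "l < k" "c < \<alpha> l" "m < n l" and Q: "Q < dim_H"
  shows "(unit_op i a b * X) $$ (hpos l c m, Q) = (if l = i \<and> c = a then X $$ (hpos i b m, Q) else 0)"
proof -
  have "unit_op i a b $$ (hpos l c m, t) * X $$ (t, Q)
      = (if t = hpos i b m then if l = i \<and> c = a then X $$ (hpos i b m, Q) else 0 else 0)"
    if "t < dim_H" for t
    using that i l by (auto simp: unit_op_def hpos_less hpos_eq_iff)
  then show ?thesis
    using i l by (auto simp: mult_index[OF unit_op_carrier X hpos_less[OF l] Q] hpos_less)
qed

lemma unit_op_mult_right:
  assumes X: "X \<in> carrier_mat dim_H dim_H" and i: "i < k" "a < \<alpha> i" "b < \<alpha> i"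
    and l: "l < k" "c < \<alpha> l" "m < n l" and P: "P < dim_H"
  shows "(X * unit_op i a b) $$ (P, hpos l c m) = (if l = i \<and> c = b then X $$ (P, hpos i a m) else 0)"
proof -
  have "X $$ (P, t) * unit_op i a b $$ (t, hpos l c m)
      = (if t = hpos i a m then if l = i \<and> c = b then X $$ (P, hpos i a m) else 0 else 0)"
    if "t < dim_H" for t
    using that i l by (auto simp: unit_op_def hpos_less hpos_eq_iff)
  then show ?thesis
    using i l by (auto simp: mult_index[OF X unit_op_carrier P hpos_less[OF l]] hpos_less)
qed

lemma unit_op_mult_both:
  assumes X: "X \<in> carrier_mat dim_H dim_H" and i: "i < k" "a < \<alpha> i" "a' < \<alpha> i"
    and j: "j < k" "b < \<alpha> j" "b' < \<alpha> j"
    and l: "l < k" "c < \<alpha> l" "p < n l" and r: "r < k" "c' < \<alpha> r" "q < n r"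
  shows "(unit_op i a a' * X * unit_op j b' b) $$ (hpos l c p, hpos r c' q)
    = (if l = i \<and> c = a \<and> r = j \<and> c' = b then X $$ (hpos i a' p, hpos j b' q) else 0)"
proof -
  have uX: "unit_op i a a' * X \<in> carrier_mat dim_H dim_H" using unit_op_carrier X by (rule mult_carrier_mat)
  show ?thesis
    unfolding unit_op_mult_right[OF uX j(1,3,2) r hpos_less[OF l]]
    using unit_op_mult_left[OF X i l, of "hpos j b' q"] j r by (auto simp: hpos_less)
qed

text \<open>Matrix units on both sides move the subblock at \<open>(a, b)\<close> to multiplicity
  position \<open>(0, 0)\<close> without leaving \<open>T\<close>.\<close>

lemma corner_of_mem:
  assumes s: "s \<in> T" and i: "i < k" "a < \<alpha> i" and j: "j < k" "b < \<alpha> j"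
  shows "corner i j (\<lambda>p q. s $$ (hpos i a p, hpos j b q))"
proof -
  have "unit_op i 0 a * s * unit_op j b 0 \<in> T"
    using left right unit_op_mem s i j multiplicity_pos by simp
  moreover have "(unit_op i 0 a * s * unit_op j b 0) $$ (hpos i 0 p, hpos j 0 q)
      = s $$ (hpos i a p, hpos j b q)" if "p < n i" "q < n j" for p q
    using that i j multiplicity_pos by (subst unit_op_mult_both[OF carrier[OF s]]) auto
  ultimately show ?thesis unfolding corner_def by (intro bexI) auto
qed

text \<open>For the converse, each subblock of \<open>x\<close> is the corner of some member of
  \<open>T\<close>; matrix units carry it back to its place and erase everything else, and the sum
  over all places is \<open>x\<close>.\<close>

lemma mem_iff:
  "x \<in> T \<longleftrightarrow> x \<in> carrier_mat dim_H dim_H \<and> (\<forall>i<k. \<forall>a<\<alpha> i. \<forall>j<k. \<forall>b<\<alpha> j.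
     corner i j (\<lambda>p q. x $$ (hpos i a p, hpos j b q)))"
proof (rule iffI)
  assume "x \<in> T"
  then show "x \<in> carrier_mat dim_H dim_H \<and> (\<forall>i<k. \<forall>a<\<alpha> i. \<forall>j<k. \<forall>b<\<alpha> j.
     corner i j (\<lambda>p q. x $$ (hpos i a p, hpos j b q)))"
    using carrier corner_of_mem by blast
next
  assume "x \<in> carrier_mat dim_H dim_H \<and> (\<forall>i<k. \<forall>a<\<alpha> i. \<forall>j<k. \<forall>b<\<alpha> j.
     corner i j (\<lambda>p q. x $$ (hpos i a p, hpos j b q)))"
  then have x: "x \<in> carrier_mat dim_H dim_H"
    and corners: "\<And>i a j b. i < k \<Longrightarrow> a < \<alpha> i \<Longrightarrow> j < k \<Longrightarrow> b < \<alpha> j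
      \<Longrightarrow> corner i j (\<lambda>p q. x $$ (hpos i a p, hpos j b q))" by auto
  \<comment> \<open>An element of \<open>I\<close> names one subblock: row summand and multiplicity
    index, then the same for columns.\<close>
  define I where "I = (SIGMA i:{..<k}. {..<\<alpha> i}) \<times> (SIGMA j:{..<k}. {..<\<alpha> j})"
  have fin: "finite I" unfolding I_def by (intro finite_cartesian_product finite_SigmaI) auto
  have "\<exists>y\<in>T. \<forall>l<k. \<forall>c<\<alpha> l. \<forall>p<n l. \<forall>r<k. \<forall>c'<\<alpha> r. \<forall>q<n r.
      y $$ (hpos l c p, hpos r c' q)
        = (if t = ((l, c), (r, c')) then x $$ (hpos l c p, hpos r c' q) else 0)"
    if "t \<in> I" for t
  proof -
    obtain i a j b where t: "t = ((i, a), (j, b))" by (metis surj_pair)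
    with that have i: "i < k" "a < \<alpha> i" and j: "j < k" "b < \<alpha> j" by (auto simp: I_def)
    obtain s where s: "s \<in> T"
        "\<forall>p<n i. \<forall>q<n j. x $$ (hpos i a p, hpos j b q) = s $$ (hpos i 0 p, hpos j 0 q)"
      using corners[OF i j] unfolding corner_def by blast
    have "unit_op i a 0 * s * unit_op j 0 b \<in> T"
      using left right unit_op_mem s i j multiplicity_pos by simp
    then show ?thesis
    proof (rule bexI[rotated], intro allI impI)
      fix l c p r c' q
      assume l: "l < k" "c < \<alpha> l" "p < n l" and r: "r < k" "c' < \<alpha> r" "q < n r"
      show "(unit_op i a 0 * s * unit_op j 0 b) $$ (hpos l c p, hpos r c' q)
          = (if t = ((l, c), (r, c')) then x $$ (hpos l c p, hpos r c' q) else 0)"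
        unfolding unit_op_mult_both[OF carrier[OF s(1)] i multiplicity_pos[OF i(1)] j
            multiplicity_pos[OF j(1)] l r]
        using s(2) l r by (auto simp: t)
    qed
  qed
  then obtain y where y: "\<And>t. t \<in> I \<Longrightarrow> y t \<in> T"
    and y_index: "\<And>t l c p r c' q. t \<in> I \<Longrightarrow> l < k \<Longrightarrow> c < \<alpha> l \<Longrightarrow> p < n l
      \<Longrightarrow> r < k \<Longrightarrow> c' < \<alpha> r \<Longrightarrow> q < n r \<Longrightarrow> y t $$ (hpos l c p, hpos r c' q)
        = (if t = ((l, c), (r, c')) then x $$ (hpos l c p, hpos r c' q) else 0)"
    by metis
  have "mat dim_H dim_H (\<lambda>PQ. \<Sum>t\<in>I. y t $$ PQ) \<in> T"
    using subspace fin y by (rule op_subspace_sum_closed)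
  moreover have "mat dim_H dim_H (\<lambda>PQ. \<Sum>t\<in>I. y t $$ PQ) = x"
  proof (rule mat_eq_hposI)
    fix l c p r c' q
    assume l: "l < k" "c < \<alpha> l" "p < n l" and r: "r < k" "c' < \<alpha> r" "q < n r"
    have "((l, c), (r, c')) \<in> I" using l r by (simp add: I_def)
    then have "(\<Sum>t\<in>I. y t $$ (hpos l c p, hpos r c' q)) = x $$ (hpos l c p, hpos r c' q)"
      using fin y_index[OF _ l r] by simp
    then show "mat dim_H dim_H (\<lambda>PQ. \<Sum>t\<in>I. y t $$ PQ) $$ (hpos l c p, hpos r c' q)
        = x $$ (hpos l c p, hpos r c' q)"
      using l r by (simp add: hpos_less)
  qed (use x in auto)
  ultimately show "x \<in> T" by simp
qed

section \<open>The skeleton system\<close>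

abbreviation R :: "complex mat set" where "R \<equiv> skeleton_system k \<alpha> n T"

text \<open>Slicing by the \<open>(1,1)\<close> matrix unit keeps only the terms with both
  multiplicity indices 0, so it restricts an operator to its corner.\<close>

lemma skeleton_mem_iff:
  "x \<in> R \<longleftrightarrow> x \<in> carrier_mat dim_L dim_L
     \<and> (\<forall>i<k. \<forall>j<k. corner i j (\<lambda>p q. x $$ (lpos i p, lpos j q)))"
proof -
  have "block n x i j \<in> skeleton_entry \<alpha> n T i j \<longleftrightarrow> corner i j (\<lambda>p q. x $$ (lpos i p, lpos j q))"
    if ij: "i < k" "j < k" for i j
  proof -
    have pos: "0 < \<alpha> i" "0 < \<alpha> j" using ij multiplicity_pos by auto
    have slice: "slice_map (n i) (n j) (unit11 (\<alpha> j) (\<alpha> i)) (block (\<lambda>l. \<alpha> l * n l) s i j)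
        = mat (n i) (n j) (\<lambda>(p, q). s $$ (hpos i 0 p, hpos j 0 q))" for s
    proof (rule eq_matI)
      fix p q assume "p < dim_row (mat (n i) (n j) (\<lambda>(p, q). s $$ (hpos i 0 p, hpos j 0 q)))"
        "q < dim_col (mat (n i) (n j) (\<lambda>(p, q). s $$ (hpos i 0 p, hpos j 0 q)))"
      then have pq: "p < n i" "q < n j" by auto
      have "(\<Sum>b<\<alpha> j. \<Sum>a<\<alpha> i. unit11 (\<alpha> j) (\<alpha> i) $$ (b, a)
            * block (\<lambda>l. \<alpha> l * n l) s i j $$ (a * n i + p, b * n j + q))
          = (\<Sum>b<\<alpha> j. \<Sum>a<\<alpha> i. if a = 0 then if b = 0 then s $$ (hpos i 0 p, hpos j 0 q) else 0 else 0)"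
        using pq pair_index_less[of 0 "\<alpha> i" p "n i"] pair_index_less[of 0 "\<alpha> j" q "n j"] pos
        by (intro sum.cong) (auto simp: unit11_def block_def hpos_def dpos_def)
      then show "slice_map (n i) (n j) (unit11 (\<alpha> j) (\<alpha> i)) (block (\<lambda>l. \<alpha> l * n l) s i j) $$ (p, q)
          = mat (n i) (n j) (\<lambda>(p, q). s $$ (hpos i 0 p, hpos j 0 q)) $$ (p, q)"
        using pq pos by (simp add: slice_map_def unit11_def)
    qed (simp_all add: slice_map_def)
    have "block n x i j = mat (n i) (n j) (\<lambda>(p, q). x $$ (lpos i p, lpos j q))"
      by (simp add: block_def dpos_def)
    then show ?thesis
      unfolding skeleton_entry_def corner_def slice image_iff by (simp add: mat_eq_iff)
  qed
  then show ?thesis by (auto simp: skeleton_system_def)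
qed

lemma operator_system_skeleton: "operator_system dim_L R"
  unfolding operator_system_def op_subspace_iff
proof (intro conjI ballI allI)
  show "R \<subseteq> carrier_mat dim_L dim_L" using skeleton_mem_iff by blast
  show "0\<^sub>m dim_L dim_L \<in> R" unfolding skeleton_mem_iff
    by (auto intro!: corner_cong[OF corner_zero] simp: lpos_less)
  show "1\<^sub>m dim_L \<in> R" unfolding skeleton_mem_iff
    by (auto intro!: corner_cong[OF corner_one] simp: lpos_less lpos_eq_iff)
  fix x assume x: "x \<in> R"
  then have xc: "x \<in> carrier_mat dim_L dim_L" by (simp add: skeleton_mem_iff)
  have xf: "corner i j (\<lambda>p q. x $$ (lpos i p, lpos j q))" if "i < k" "j < k" for i j
    using x that by (simp add: skeleton_mem_iff)
  have "corner i j (\<lambda>p q. mat_adjoint x $$ (lpos i p, lpos j q))" if "i < k" "j < k" for i j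
    by (rule corner_cong[OF corner_adjoint[OF that(2,1) xf[OF that(2,1)]]])
      (use that in \<open>simp add: lpos_less adjoint_index[OF xc]\<close>)
  then show "mat_adjoint x \<in> R" using xc by (simp add: skeleton_mem_iff)
  have "corner i j (\<lambda>p q. (z \<cdot>\<^sub>m x) $$ (lpos i p, lpos j q))" if "i < k" "j < k" for z i j
    by (rule corner_cong[OF corner_smult[OF that xf[OF that], of z]])
      (use that xc in \<open>simp add: lpos_less\<close>)
  then show "z \<cdot>\<^sub>m x \<in> R" for z using xc by (simp add: skeleton_mem_iff)
  fix y assume y: "y \<in> R"
  then have yc: "y \<in> carrier_mat dim_L dim_L" by (simp add: skeleton_mem_iff)
  have yf: "corner i j (\<lambda>p q. y $$ (lpos i p, lpos j q))" if "i < k" "j < k" for i j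
    using y that by (simp add: skeleton_mem_iff)
  have "corner i j (\<lambda>p q. (x + y) $$ (lpos i p, lpos j q))" if "i < k" "j < k" for i j
    by (rule corner_cong[OF corner_add[OF that xf[OF that] yf[OF that]]])
      (use that xc yc in \<open>simp add: lpos_less\<close>)
  then show "x + y \<in> R" using xc yc by (simp add: skeleton_mem_iff)
qed

text \<open>Elements of the commutant of the block-diagonal algebra act as one scalar on each
  summand. Multiplying by them on both sides only rescales each block of \<open>s\<close>, and
  skeleton entries are linear subspaces.\<close>

lemma quantum_graph_skeleton: "quantum_graph dim_L R (block_diagonal_algebra k n)"
  unfolding quantum_graph_def
proof (intro conjI ballI von_neumann_block_diagonal operator_system_skeleton)
  fix a s b
  assume a: "a \<in> commutant dim_L (block_diagonal_algebra k n)" and s: "s \<in> R"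
    and b: "b \<in> commutant dim_L (block_diagonal_algebra k n)"
  from a obtain z where ac: "a \<in> carrier_mat dim_L dim_L" and
    z: "\<forall>i<k. \<forall>m<n i. \<forall>j<k. \<forall>m'<n j. a $$ (lpos i m, lpos j m') = (if i = j \<and> m = m' then z i else 0)"
    unfolding commutant_block_diagonal_iff by blast
  from b obtain w where bc: "b \<in> carrier_mat dim_L dim_L" and
    w: "\<forall>i<k. \<forall>m<n i. \<forall>j<k. \<forall>m'<n j. b $$ (lpos i m, lpos j m') = (if i = j \<and> m = m' then w i else 0)"
    unfolding commutant_block_diagonal_iff by blast
  have sc: "s \<in> carrier_mat dim_L dim_L" using s by (simp add: skeleton_mem_iff)
  have asc: "a * s \<in> carrier_mat dim_L dim_L" using ac sc by simp
  have l: "(a * s) $$ (lpos i m, Q) = z i * s $$ (lpos i m, Q)" if "i < k" "m < n i" "Q < dim_L" for i m Q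
    unfolding mult_index[OF ac sc lpos_less[OF that(1,2)] that(3)] using that z
    by (subst sum_lpos[of i]) (auto simp: mult_if_zero)
  have asb: "(a * s * b) $$ (lpos i m, lpos j m') = (w j * z i) * s $$ (lpos i m, lpos j m')"
    if "i < k" "m < n i" "j < k" "m' < n j" for i m j m'
    unfolding mult_index[OF asc bc lpos_less[OF that(1,2)] lpos_less[OF that(3,4)]] using that w
    by (subst sum_lpos[of j]) (auto simp: l lpos_less mult_if_zero)
  have "corner i j (\<lambda>p q. (a * s * b) $$ (lpos i p, lpos j q))" if "i < k" "j < k" for i j
  proof (rule corner_cong)
    show "corner i j (\<lambda>p q. (w j * z i) * s $$ (lpos i p, lpos j q))"
      using s that by (intro corner_smult) (simp_all add: skeleton_mem_iff)
  qed (use asb that in simp)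
  then show "a * s * b \<in> R" using asc bc by (simp add: skeleton_mem_iff)
qed

section \<open>The Kraus operators\<close>

definition kraus_op :: "nat \<Rightarrow> complex mat" where
  "kraus_op a = mat dim_L dim_H
     (\<lambda>(P, Q). if \<exists>i<k. \<exists>m<n i. a < \<alpha> i \<and> P = lpos i m \<and> Q = hpos i a m then 1 else 0)"

lemma kraus_op_carrier: "kraus_op a \<in> carrier_mat dim_L dim_H"
  by (simp add: kraus_op_def)

lemma kraus_op_index_row:
  assumes "i < k" "m < n i" "Q < dim_H"
  shows "kraus_op a $$ (lpos i m, Q) = (if a < \<alpha> i \<and> Q = hpos i a m then 1 else 0)"
  using assms by (auto simp: kraus_op_def lpos_less lpos_eq_iff)

lemma kraus_op_index_col:
  assumes "i < k" "c < \<alpha> i" "m < n i" "P < dim_L"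
  shows "kraus_op a $$ (P, hpos i c m) = (if c = a \<and> P = lpos i m then 1 else 0)"
  using assms by (auto simp: kraus_op_def hpos_less hpos_eq_iff)

text \<open>A column \<open>hpos i c m\<close> of \<open>kraus_op a\<close> can be nonzero only in
  row \<open>lpos i m\<close>, and only for \<open>c = a\<close>. Both matrix products therefore
  reduce to one term: the blocks of \<open>x\<close> are inserted at multiplicity position
  \<open>(a, b)\<close>.\<close>

lemma kraus_compress_index:
  assumes x: "x \<in> carrier_mat dim_L dim_L"
    and i: "i < k" "c < \<alpha> i" "m < n i" and j: "j < k" "c' < \<alpha> j" "m' < n j"
  shows "(mat_adjoint (kraus_op a) * x * kraus_op b) $$ (hpos i c m, hpos j c' m')
    = (if c = a \<and> c' = b then x $$ (lpos i m, lpos j m') else 0)"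
proof -
  note Va = adjoint_carrier[OF kraus_op_carrier[of a]]
  have Vx: "mat_adjoint (kraus_op a) * x \<in> carrier_mat dim_H dim_L" using Va x by (rule mult_carrier_mat)
  have l: "(mat_adjoint (kraus_op a) * x) $$ (hpos i c m, Q) = (if c = a then x $$ (lpos i m, Q) else 0)"
    if Q: "Q < dim_L" for Q
  proof -
    have "mat_adjoint (kraus_op a) $$ (hpos i c m, t) * x $$ (t, Q)
        = (if t = lpos i m then if c = a then x $$ (lpos i m, Q) else 0 else 0)" if "t < dim_L" for t
      using that i by (auto simp: adjoint_index[OF kraus_op_carrier] hpos_less kraus_op_index_col)
    then show ?thesis using i by (simp add: mult_index[OF Va x hpos_less[OF i] Q] lpos_less)
  qed
  have "(mat_adjoint (kraus_op a) * x) $$ (hpos i c m, t) * kraus_op b $$ (t, hpos j c' m')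
      = (if t = lpos j m' then if c = a \<and> c' = b then x $$ (lpos i m, lpos j m') else 0 else 0)"
    if "t < dim_L" for t
    using that j by (auto simp: l kraus_op_index_col)
  then show ?thesis
    using j by (simp add: mult_index[OF Vx kraus_op_carrier hpos_less[OF i] hpos_less[OF j]] lpos_less)
qed

lemma kraus_expand_index:
  assumes s: "s \<in> carrier_mat dim_H dim_H"
    and i: "i < k" "m < n i" and j: "j < k" "m' < n j"
  shows "(kraus_op a * s * mat_adjoint (kraus_op b)) $$ (lpos i m, lpos j m')
    = (if a < \<alpha> i \<and> b < \<alpha> j then s $$ (hpos i a m, hpos j b m') else 0)"
proof -
  note Vb = adjoint_carrier[OF kraus_op_carrier[of b]]
  have Vs: "kraus_op a * s \<in> carrier_mat dim_L dim_H" using kraus_op_carrier s by (rule mult_carrier_mat)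
  have l: "(kraus_op a * s) $$ (lpos i m, Q) = (if a < \<alpha> i then s $$ (hpos i a m, Q) else 0)"
    if Q: "Q < dim_H" for Q
  proof -
    have "kraus_op a $$ (lpos i m, t) * s $$ (t, Q)
        = (if t = hpos i a m then if a < \<alpha> i then s $$ (hpos i a m, Q) else 0 else 0)" if "t < dim_H" for t
      using that i by (auto simp: kraus_op_index_row)
    then show ?thesis using i
      by (simp add: mult_index[OF kraus_op_carrier s lpos_less[OF i] Q] hpos_less)
  qed
  have "(kraus_op a * s) $$ (lpos i m, t) * mat_adjoint (kraus_op b) $$ (t, lpos j m')
      = (if t = hpos j b m' then if a < \<alpha> i \<and> b < \<alpha> j then s $$ (hpos i a m, hpos j b m') else 0 else 0)"
    if "t < dim_H" for t
    using that j by (auto simp: l adjoint_index[OF kraus_op_carrier] lpos_less kraus_op_index_row)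
  then show ?thesis
    using j by (auto simp: mult_index[OF Vs Vb lpos_less[OF i] lpos_less[OF j]] hpos_less)
qed

text \<open>Every subblock of the product is either a block of \<open>x\<close> or zero, and both
  lie in the skeleton entry; \<open>mem_iff\<close> does the rest.\<close>

lemma kraus_compress_mem:
  assumes x: "x \<in> R"
  shows "mat_adjoint (kraus_op a) * x * kraus_op b \<in> T"
proof -
  have xc: "x \<in> carrier_mat dim_L dim_L" using x by (simp add: skeleton_mem_iff)
  have "mat_adjoint (kraus_op a) * x * kraus_op b \<in> carrier_mat dim_H dim_H"
    by (rule mult_carrier_mat[OF mult_carrier_mat[OF adjoint_carrier[OF kraus_op_carrier] xc] kraus_op_carrier])
  moreover have "corner i j (\<lambda>p q. (mat_adjoint (kraus_op a) * x * kraus_op b) $$ (hpos i c p, hpos j c' q))"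
    if "i < k" "c < \<alpha> i" "j < k" "c' < \<alpha> j" for i c j c'
  proof (cases "c = a \<and> c' = b")
    case True
    have "corner i j (\<lambda>p q. x $$ (lpos i p, lpos j q))" using x that by (simp add: skeleton_mem_iff)
    then show ?thesis by (rule corner_cong) (use that True kraus_compress_index[OF xc] in simp)
  next
    case False
    show ?thesis
      by (rule corner_cong[OF corner_zero]) (use that False kraus_compress_index[OF xc] in auto)
  qed
  ultimately show ?thesis unfolding mem_iff by blast
qed

lemma kraus_expand_mem:
  assumes s: "s \<in> T"
  shows "kraus_op a * s * mat_adjoint (kraus_op b) \<in> R"
proof -
  note sc = carrier[OF s]
  have "kraus_op a * s * mat_adjoint (kraus_op b) \<in> carrier_mat dim_L dim_L"
    by (rule mult_carrier_mat[OF mult_carrier_mat[OF kraus_op_carrier sc] adjoint_carrier[OF kraus_op_carrier]])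
  moreover have "corner i j (\<lambda>p q. (kraus_op a * s * mat_adjoint (kraus_op b)) $$ (lpos i p, lpos j q))"
    if "i < k" "j < k" for i j
  proof (cases "a < \<alpha> i \<and> b < \<alpha> j")
    case True
    then have "corner i j (\<lambda>p q. s $$ (hpos i a p, hpos j b q))" using s that by (simp add: corner_of_mem)
    then show ?thesis by (rule corner_cong) (use that True kraus_expand_index[OF sc] in simp)
  next
    case False
    show ?thesis
      by (rule corner_cong[OF corner_zero]) (use that False kraus_expand_index[OF sc] in auto)
  qed
  ultimately show ?thesis unfolding skeleton_mem_iff by blast
qed

section \<open>The homomorphism from the block-diagonal algebra\<close>

abbreviation C :: "complex mat set" where "C \<equiv> block_diagonal_algebra k n"

text \<open>On block-diagonal \<open>x\<close> this is the direct sum of the I_\<alpha> tensor x_i.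
  The number of Kraus operators is the sum of the multiplicities, a convenient common bound for all
  \<open>\<alpha> i\<close>; operators with larger index than every multiplicity are zero.\<close>

definition amplify :: "complex mat \<Rightarrow> complex mat" where
  "amplify x = mat dim_H dim_H
     (\<lambda>PQ. \<Sum>c<(\<Sum>i<k. \<alpha> i). (mat_adjoint (kraus_op c) * x * kraus_op c) $$ PQ)"

lemma amplify_carrier: "amplify x \<in> carrier_mat dim_H dim_H"
  by (simp add: amplify_def)

lemma diagonal_carrier: "x \<in> C \<Longrightarrow> x \<in> carrier_mat dim_L dim_L"
  by (simp add: block_diagonal_algebra_iff)

lemma amplify_index:
  assumes x: "x \<in> carrier_mat dim_L dim_L"
    and i: "i < k" "a < \<alpha> i" "m < n i" and j: "j < k" "b < \<alpha> j" "m' < n j"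
  shows "amplify x $$ (hpos i a m, hpos j b m') = (if a = b then x $$ (lpos i m, lpos j m') else 0)"
proof -
  have "\<alpha> i \<le> (\<Sum>i<k. \<alpha> i)" using i(1) by (intro member_le_sum) auto
  then have "a < (\<Sum>i<k. \<alpha> i)" using i(2) by simp
  moreover have "amplify x $$ (hpos i a m, hpos j b m')
      = (\<Sum>c<(\<Sum>i<k. \<alpha> i). if c = a then if a = b then x $$ (lpos i m, lpos j m') else 0 else 0)"
    unfolding amplify_def index_mat(1)[OF hpos_less[OF i] hpos_less[OF j]] kraus_compress_index[OF x i j]
    by (intro sum.cong) auto
  ultimately show ?thesis by simp
qed

text \<open>Block-diagonality of \<open>x\<close> confines the intermediate index to summand
  \<open>i\<close>, where multiplicity position \<open>a\<close> exists. The sum over H then becomes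
  the sum over L defining \<open>x * y\<close>.\<close>

lemma amplify_mult:
  assumes x: "x \<in> C" and y: "y \<in> C"
  shows "amplify (x * y) = amplify x * amplify y"
proof (rule mat_eq_hposI[OF amplify_carrier mult_carrier_mat[OF amplify_carrier amplify_carrier]])
  note xc = diagonal_carrier[OF x] and yc = diagonal_carrier[OF y]
  fix i a m j b m'
  assume i: "i < k" "a < \<alpha> i" "m < n i" and j: "j < k" "b < \<alpha> j" "m' < n j"
  have x0: "x $$ (lpos i m, lpos l q) = 0" if "l < k" "q < n l" "l \<noteq> i" for l q
    using x that i unfolding block_diagonal_algebra_iff by auto
  have "(amplify x * amplify y) $$ (hpos i a m, hpos j b m')
      = (\<Sum>q<n i. amplify x $$ (hpos i a m, hpos i a q) * amplify y $$ (hpos i a q, hpos j b m'))"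
    unfolding mult_index[OF amplify_carrier amplify_carrier hpos_less[OF i] hpos_less[OF j]]
    using i j x0 by (intro sum_hpos_space) (auto simp: amplify_index[OF xc])
  also have "\<dots> = (if a = b then \<Sum>q<n i. x $$ (lpos i m, lpos i q) * y $$ (lpos i q, lpos j m') else 0)"
    using i j by (simp add: amplify_index[OF xc] amplify_index[OF yc])
  also have "(\<Sum>q<n i. x $$ (lpos i m, lpos i q) * y $$ (lpos i q, lpos j m')) = (x * y) $$ (lpos i m, lpos j m')"
    unfolding mult_index[OF xc yc lpos_less[OF i(1,3)] lpos_less[OF j(1,3)]]
    using i x0 by (intro sum_lpos[symmetric]) auto
  finally show "amplify (x * y) $$ (hpos i a m, hpos j b m') = (amplify x * amplify y) $$ (hpos i a m, hpos j b m')"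
    using amplify_index[OF mult_carrier_mat[OF xc yc] i j] by simp
qed

text \<open>Operators I tensor x and A tensor I commute: both products have the entry x times A in
  equal summands and zero elsewhere.\<close>

lemma amplify_commutes:
  assumes x: "x \<in> C" and N: "N \<in> ampliated_algebra k \<alpha> n"
  shows "amplify x * N = N * amplify x"
proof -
  note xc = diagonal_carrier[OF x]
  obtain A where Nc: "N \<in> carrier_mat dim_H dim_H" and
    A: "\<And>i a m j b m'. i < k \<Longrightarrow> a < \<alpha> i \<Longrightarrow> m < n i \<Longrightarrow> j < k \<Longrightarrow> b < \<alpha> j \<Longrightarrow> m' < n j
      \<Longrightarrow> N $$ (hpos i a m, hpos j b m') = (if i = j \<and> m = m' then A i a b else 0)"
    using N unfolding ampliated_algebra_iff by auto
  show ?thesis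
  proof (rule mat_eq_hposI[OF mult_carrier_mat[OF amplify_carrier Nc] mult_carrier_mat[OF Nc amplify_carrier]])
    fix i a m j b m'
    assume i: "i < k" "a < \<alpha> i" "m < n i" and j: "j < k" "b < \<alpha> j" "m' < n j"
    have x0: "x $$ (lpos i m, lpos j m') = 0" if "i \<noteq> j"
      using x that i j unfolding block_diagonal_algebra_iff by auto
    have "(amplify x * N) $$ (hpos i a m, hpos j b m')
        = (\<Sum>c<\<alpha> j. amplify x $$ (hpos i a m, hpos j c m') * N $$ (hpos j c m', hpos j b m'))"
      unfolding mult_index[OF amplify_carrier Nc hpos_less[OF i] hpos_less[OF j]]
      using i j by (intro sum_hpos_multiplicity) (auto simp: A)
    also have "\<dots> = (\<Sum>c<\<alpha> j. if c = a then x $$ (lpos i m, lpos j m') * A j a b else 0)"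
      using i j by (intro sum.cong) (auto simp: A amplify_index[OF xc])
    also have "\<dots> = (if i = j then x $$ (lpos i m, lpos j m') * A i a b else 0)"
      using i x0 by auto
    also have "\<dots> = (\<Sum>c<\<alpha> i. if c = b then x $$ (lpos i m, lpos j m') * A i a b else 0)"
      using j x0 by auto
    also have "\<dots> = (\<Sum>c<\<alpha> i. N $$ (hpos i a m, hpos i c m) * amplify x $$ (hpos i c m, hpos j b m'))"
      using i j by (intro sum.cong) (auto simp: A amplify_index[OF xc])
    also have "\<dots> = (N * amplify x) $$ (hpos i a m, hpos j b m')"
      unfolding mult_index[OF Nc amplify_carrier hpos_less[OF i] hpos_less[OF j]]
      using i j by (intro sum_hpos_multiplicity[symmetric]) (auto simp: A)
    finally show "(amplify x * N) $$ (hpos i a m, hpos j b m') = (N * amplify x) $$ (hpos i a m, hpos j b m')" .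
  qed
qed

lemma amplify_add:
  assumes x: "x \<in> C" and y: "y \<in> C"
  shows "amplify (x + y) = amplify x + amplify y"
  using diagonal_carrier[OF x] diagonal_carrier[OF y] amplify_carrier[of x] amplify_carrier[of y]
  by (intro mat_eq_hposI[OF amplify_carrier]) (auto simp: amplify_index hpos_less lpos_less)

lemma amplify_smult:
  assumes x: "x \<in> C"
  shows "amplify (z \<cdot>\<^sub>m x) = z \<cdot>\<^sub>m amplify x"
  using diagonal_carrier[OF x] amplify_carrier[of x]
  by (intro mat_eq_hposI[OF amplify_carrier]) (auto simp: amplify_index hpos_less lpos_less)

lemma amplify_adjoint:
  assumes x: "x \<in> C"
  shows "amplify (mat_adjoint x) = mat_adjoint (amplify x)"
  using diagonal_carrier[OF x]
  by (intro mat_eq_hposI[OF amplify_carrier adjoint_carrier[OF amplify_carrier]])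
    (auto simp: amplify_index adjoint_index[OF amplify_carrier] adjoint_index[of x] hpos_less lpos_less)

lemma amplify_one: "amplify (1\<^sub>m dim_L) = 1\<^sub>m dim_H"
  by (intro mat_eq_hposI[OF amplify_carrier])
    (auto simp: amplify_index hpos_less lpos_less hpos_eq_iff lpos_eq_iff)

text \<open>The entries of \<open>x\<close> can be read back at multiplicity position 0, present in
  each summand since \<open>\<alpha> i\<close> is positive.\<close>

lemma amplify_inj:
  assumes x: "x \<in> C" and y: "y \<in> C" and eq: "amplify x = amplify y"
  shows "x = y"
proof (rule mat_eq_lposI[OF diagonal_carrier[OF x] diagonal_carrier[OF y]])
  fix i m j m' assume i: "i < k" "m < n i" and j: "j < k" "m' < n j"
  then show "x $$ (lpos i m, lpos j m') = y $$ (lpos i m, lpos j m')"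
    using amplify_index[OF diagonal_carrier[OF x] i(1) multiplicity_pos[OF i(1)] i(2)
        j(1) multiplicity_pos[OF j(1)] j(2)]
      amplify_index[OF diagonal_carrier[OF y] i(1) multiplicity_pos[OF i(1)] i(2)
        j(1) multiplicity_pos[OF j(1)] j(2)] eq by simp
qed

end

section \<open>Transport to the original Hilbert space and the full pullback\<close>

theorem proposition3p13:
  fixes d e :: nat and S A R C :: "complex mat set"
  assumes "quantum_graph d S A"
    and "acts_irreducibly d S"
    and "is_skeleton d S e R C"
  shows "quantum_graph e R C \<and> full_pullback d S A e R C"
proof -
  obtain k \<alpha> n U where dec: "multiplier_decomposition d S k \<alpha> n U" and e: "e = (\<Sum>i<k. n i)"
    and R: "R = skeleton_system k \<alpha> n (conj_by U S)" and C: "C = block_diagonal_algebra k n"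
    using assms(3) unfolding is_skeleton_def by blast
  have d: "d = (\<Sum>i<k. \<alpha> i * n i)" and U: "unitary_op d U"
    and mult: "conj_by U (multiplier_algebra d S) = ampliated_algebra k \<alpha> n"
    using dec by (auto simp: multiplier_decomposition_def)
  define W where "W = mat_adjoint U"
  have Uc: "U \<in> carrier_mat d d" and WU: "W * U = 1\<^sub>m d" and UW: "U * W = 1\<^sub>m d"
    using U by (auto simp: unitary_op_def W_def)
  have Wc: "W \<in> carrier_mat d d" using Uc by (simp add: W_def)
  have WadjU: "mat_adjoint W = U" using adjoint_adjoint[OF Uc] by (simp add: W_def)
  have S: "operator_system d S" and A: "von_neumann_algebra d A"
    using assms(1) by (auto simp: quantum_graph_def)
  have Sc: "s \<in> carrier_mat d d" if "s \<in> S" for s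
    using S that by (auto simp: operator_system_def op_subspace_iff)
  have Mc: "a \<in> carrier_mat d d" if "a \<in> multiplier_algebra d S" for a
    using multiplier_carrier[OF S] that by blast
  have conj_mem: "U * s * W \<in> conj_by U B" if "s \<in> B" for s B
    using that by (auto simp: conj_by_def W_def)
  have conj_cases: "\<exists>s\<in>B. t = U * s * W" if "t \<in> conj_by U B" for t B
    using that by (auto simp: conj_by_def W_def)
  \<comment> \<open>Conjugation by \<open>U\<close> is multiplicative and maps the multiplier
    algebra onto the ampliated algebra, so the bimodule property of \<open>S\<close> carries
    over.\<close>
  interpret bimodule_system k \<alpha> n "conj_by U S"
  proof unfold_locales
    show "0 < \<alpha> i" if "i < k" for i using dec that by (simp add: multiplier_decomposition_def)
    show "operator_system (\<Sum>i<k. \<alpha> i * n i) (conj_by U S)"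
      using operator_system_conj[OF S U] unfolding d .
    fix a s
    assume "a \<in> ampliated_algebra k \<alpha> n" and "s \<in> conj_by U S"
    then obtain a' s' where a': "a' \<in> multiplier_algebra d S" "a = U * a' * W"
      and s': "s' \<in> S" "s = U * s' * W"
      using conj_cases mult by metis
    have "a' * s' \<in> S" using a' s' by (simp add: multiplier_algebra_def)
    then show "a * s \<in> conj_by U S"
      using conj_mult[OF Uc Wc Mc[OF a'(1)] Sc[OF s'(1)] WU] conj_mem a' s' by metis
    have "s' * a' \<in> S" using multiplier_right[OF S a'(1) s'(1)] .
    then show "s * a \<in> conj_by U S"
      using conj_mult[OF Uc Wc Sc[OF s'(1)] Mc[OF a'(1)] WU] conj_mem a' s' by metis
  qed
  have T_back: "W * t * U \<in> S" if "t \<in> conj_by U S" for t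
    using conj_cases[OF that] conj_conj[OF Uc Wc _ WU] Sc by metis
  define r where "r = (\<Sum>i<k. \<alpha> i)"
  \<comment> \<open>The model Kraus operators are precomposed with \<open>U\<close> so that they act
    on the original H; accordingly \<open>\<theta>\<close> conjugates \<open>amplify\<close>
    back.\<close>
  define v where "v c = kraus_op c * U" for c
  define \<theta> where "\<theta> x = W * amplify x * U" for x
  have kc: "kraus_op c \<in> carrier_mat e d" for c using kraus_op_carrier by (simp add: e d)
  have vc: "v c \<in> carrier_mat e d" for c unfolding v_def by (rule mult_carrier_mat[OF kc Uc])
  have ac: "amplify x \<in> carrier_mat d d" for x using amplify_carrier by (simp add: d)
  have \<theta>c: "\<theta> x \<in> carrier_mat d d" for x
    unfolding \<theta>_def by (rule mult_carrier_mat[OF mult_carrier_mat[OF Wc ac] Uc])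
  have Cc: "x \<in> carrier_mat e e" if "x \<in> C" for x using diagonal_carrier that by (simp add: C e)
  have kk: "mat_adjoint (kraus_op a) * x * kraus_op b \<in> carrier_mat d d" if "x \<in> carrier_mat e e" for a b x
    by (rule mult_carrier_mat[OF mult_carrier_mat[OF adjoint_carrier[OF kc] that] kc])
  \<comment> \<open>Gathers the unitaries on the outside. The factors have different shapes, so each
    reassociation is given its dimensions explicitly.\<close>
  have compress: "mat_adjoint (v a) * x * v b = W * (mat_adjoint (kraus_op a) * x * kraus_op b) * U"
    if x: "x \<in> carrier_mat e e" for a b x
  proof -
    note ka = adjoint_carrier[OF kc[of a]]
    have "mat_adjoint (v a) * x * v b = W * mat_adjoint (kraus_op a) * x * (kraus_op b * U)"
      unfolding v_def adjoint_mult[OF kc Uc] W_def ..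
    also have "\<dots> = W * (mat_adjoint (kraus_op a) * x) * (kraus_op b * U)"
      by (simp only: assoc_mult_mat[OF Wc ka x])
    also have "\<dots> = W * (mat_adjoint (kraus_op a) * x) * kraus_op b * U"
      by (rule assoc_mult_mat[OF mult_carrier_mat[OF Wc mult_carrier_mat[OF ka x]] kc Uc, symmetric])
    also have "\<dots> = W * (mat_adjoint (kraus_op a) * x * kraus_op b) * U"
      by (simp only: assoc_mult_mat[OF Wc mult_carrier_mat[OF ka x] kc])
    finally show ?thesis .
  qed
  have expand: "v a * s * mat_adjoint (v b) = kraus_op a * (U * s * W) * mat_adjoint (kraus_op b)"
    if s: "s \<in> carrier_mat d d" for a b s
  proof -
    note kb = adjoint_carrier[OF kc[of b]]
    have "v a * s * mat_adjoint (v b) = kraus_op a * U * s * (W * mat_adjoint (kraus_op b))"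
      unfolding v_def adjoint_mult[OF kc Uc] W_def ..
    also have "\<dots> = kraus_op a * (U * s) * (W * mat_adjoint (kraus_op b))"
      by (simp only: assoc_mult_mat[OF kc Uc s])
    also have "\<dots> = kraus_op a * (U * s) * W * mat_adjoint (kraus_op b)"
      by (rule assoc_mult_mat[OF mult_carrier_mat[OF kc mult_carrier_mat[OF Uc s]] Wc kb, symmetric])
    also have "\<dots> = kraus_op a * (U * s * W) * mat_adjoint (kraus_op b)"
      by (simp only: assoc_mult_mat[OF kc mult_carrier_mat[OF Uc s] Wc])
    finally show ?thesis .
  qed
  have "quantum_graph e R C" using quantum_graph_skeleton by (simp add: e R C)
  moreover have "faithful_unital_star_hom e C d A \<theta>"
    unfolding faithful_unital_star_hom_def
  proof (intro conjI ballI allI)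
    show "\<theta> (1\<^sub>m e) = 1\<^sub>m d"
      using amplify_one Wc WU by (simp add: \<theta>_def e d)
    show "inj_on \<theta> C"
    proof (rule inj_onI)
      fix x y assume xy: "x \<in> C" "y \<in> C" "\<theta> x = \<theta> y"
      have "U * (W * amplify z * U) * W = amplify z" for z
        using conj_conj[OF Wc Uc ac UW] .
      then have "amplify x = amplify y" using xy(3) unfolding \<theta>_def by metis
      then show "x = y" using amplify_inj xy by (simp add: C)
    qed
    fix x assume x: "x \<in> C"
    \<comment> \<open>Here \<open>A\<close> enters: \<open>b\<close> is a multiplier, so its
      conjugate lies in the ampliated algebra and commutes with \<open>amplify x\<close>.
      Conjugating back puts \<open>\<theta> x\<close> into the bicommutant of \<open>A\<close>,
      which is \<open>A\<close>.\<close>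
    have "\<theta> x * b = b * \<theta> x" if b: "b \<in> commutant d A" for b
    proof -
      have bc: "b \<in> carrier_mat d d" using b by (simp add: commutant_def)
      have UbW: "U * b * W \<in> carrier_mat d d" using Uc bc Wc by simp
      have "U * b * W \<in> ampliated_algebra k \<alpha> n"
        using conj_mem commutant_subset_multiplier[OF assms(1)] b mult by blast
      then have eq: "amplify x * (U * b * W) = (U * b * W) * amplify x"
        using amplify_commutes x by (simp add: C)
      have "\<theta> x * (W * (U * b * W) * U) = (W * (U * b * W) * U) * \<theta> x"
        unfolding \<theta>_def conj_mult[OF Wc Uc ac UbW UW] conj_mult[OF Wc Uc UbW ac UW] eq ..
      then show ?thesis by (simp only: conj_conj[OF Uc Wc bc WU])
    qed
    then have "\<theta> x \<in> commutant d (commutant d A)" using \<theta>c by (simp add: commutant_def)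
    then show "\<theta> x \<in> A" using A by (simp add: von_neumann_algebra_def)
    show "\<theta> (z \<cdot>\<^sub>m x) = z \<cdot>\<^sub>m \<theta> x" for z
      using amplify_smult[of x z] x ac[of x] Wc Uc
      by (simp add: \<theta>_def C mult_smult_distrib[of _ d d _ d] mult_smult_assoc_mat[of _ d d _ d])
    show "\<theta> (mat_adjoint x) = mat_adjoint (\<theta> x)"
      using amplify_adjoint[of x] x conj_adjoint[OF Wc ac[of x]] unfolding WadjU by (simp add: \<theta>_def C)
    fix y assume y: "y \<in> C"
    show "\<theta> (x + y) = \<theta> x + \<theta> y"
      using amplify_add[of x y] x y ac[of x] ac[of y] Wc Uc
      by (simp add: \<theta>_def C mult_add_distrib_mat[of _ d d] add_mult_distrib_mat[of _ d d])
    show "\<theta> (x * y) = \<theta> x * \<theta> y"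
      using amplify_mult[of x y] x y conj_mult[OF Wc Uc ac ac UW] by (simp add: \<theta>_def C)
  qed
  moreover have "kraus_family e C d \<theta> r v"
    unfolding kraus_family_def
  proof (intro conjI allI impI ballI vc)
    fix x assume x: "x \<in> C"
    note xc = Cc[OF x]
    let ?f = "\<lambda>c. mat_adjoint (v c) * x * v c"
    let ?g = "\<lambda>c. mat_adjoint (kraus_op c) * x * kraus_op c"
    have fc: "?f c \<in> carrier_mat d d" for c
      by (rule mult_carrier_mat[OF mult_carrier_mat[OF adjoint_carrier[OF vc] xc] vc])
    have "amplify x = mat d d (\<lambda>PQ. \<Sum>c<r. ?g c $$ PQ)" by (simp add: amplify_def d r_def)
    \<comment> \<open>\<open>W\<close> and then \<open>U\<close> are moved inside the sum, where
      \<open>compress\<close> turns each term into the Kraus term of \<open>v c\<close>.\<close>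
    then have "\<theta> x = mat d d (\<lambda>PQ. \<Sum>c<r. (W * ?g c) $$ PQ) * U"
      unfolding \<theta>_def using mult_sum_left[OF Wc, of "{..<r}" ?g d] kk[OF xc] by simp
    also have "\<dots> = mat d d (\<lambda>PQ. \<Sum>c<r. ?f c $$ PQ)"
      unfolding compress[OF xc]
      by (rule mult_sum_right[OF Uc mult_carrier_mat[OF Wc kk[OF xc]]])
    also have "\<dots> = finsum (module_mat TYPE(complex) d d) ?f {..<r}"
    proof (rule eq_matI)
      fix P Q
      let ?M = "finsum (module_mat TYPE(complex) d d) ?f {..<r}"
      have M: "?M \<in> carrier_mat d d" using fc by (intro finsum_mat_carrier) auto
      assume "P < dim_row ?M" "Q < dim_col ?M"
      then have PQ: "P < d" "Q < d" using M by auto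
      then show "mat d d (\<lambda>PQ. \<Sum>c<r. ?f c $$ PQ) $$ (P, Q) = ?M $$ (P, Q)"
        using finsum_mat_index[of "{..<r}" ?f d d P Q] fc by simp
    qed (use finsum_mat_carrier[of "{..<r}" ?f d d] fc in auto)
    finally show "\<theta> x = finsum (module_mat TYPE(complex) d d) ?f {..<r}" .
  qed
  \<comment> \<open>Both inclusions hold in the model for \<open>conj_by U S\<close>;
    \<open>T_back\<close> and \<open>conj_mem\<close> translate them to \<open>S\<close>.\<close>
  moreover have "mat_adjoint (v a) * x * v b \<in> S" if "x \<in> R" for a b x
  proof -
    have "x \<in> carrier_mat e e" using that skeleton_mem_iff by (simp add: R e)
    then show ?thesis using compress T_back[OF kraus_compress_mem] that R by simp
  qed
  moreover have "v a * s * mat_adjoint (v b) \<in> R" if "s \<in> S" for a b s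
    using expand[OF Sc[OF that]] kraus_expand_mem[OF conj_mem[OF that]] R by simp
  ultimately show ?thesis unfolding full_pullback_def by blast
qed

end
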